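(* Given a graph $G=(V,E)$ together with a linear arrangement $\ell$ of $G$ of cutwidth at most $\mathrm{ctw}$, and a positive integer $k$, the Odd Cycle Transversal problem can be solved in time $\mathcal{O}^*(2^{\mathrm{ctw}})$.
   Context: Graphs are finite, simple, loopless and undirected. A linear arrangement of $G=(V,E)$ with $n=|V|$ is a bijection $\ell\colon \{1,\dots,n\}\to V$; write $v_i=\ell(i)$. The $i$th cut is $E_i=\{\{v_j,v_k\}\in E : j\le i<k\}$, and the cutwidth of $\ell$ is $\max_{i}|E_i|$. $\mathcal{O}^*$ hides factors polynomial in the input size. Odd Cycle Transversal: given a graph $G=(V,E)$ and an integer $k$, decide whether there is a subset $S\subseteq V$ of cardinality at most $k$ such that $G-S$ is bipartite. *)

theory Defs
  imports "HOL-Library.Log_Nat" "HOL-Computational_Algebra.Polynomial"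
begin

section \<open>Graphs, linear arrangements and cutwidth\<close>

definition simple_graph :: "'a set \<Rightarrow> 'a set set \<Rightarrow> bool" where
  "simple_graph V E \<longleftrightarrow> finite V \<and> (\<forall>e\<in>E. \<exists>u\<in>V. \<exists>v\<in>V. u \<noteq> v \<and> e = {u, v})"

definition linear_arrangement :: "'a set \<Rightarrow> (nat \<Rightarrow> 'a) \<Rightarrow> bool" where
  "linear_arrangement V l \<longleftrightarrow> bij_betw l {1..card V} V"

definition cut :: "'a set \<Rightarrow> 'a set set \<Rightarrow> (nat \<Rightarrow> 'a) \<Rightarrow> nat \<Rightarrow> 'a set set" where
  "cut V E l i =
    {e \<in> E. \<exists>j\<in>{1..card V}. \<exists>k\<in>{1..card V}. e = {l j, l k} \<and> j \<le> i \<and> i < k}"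

text \<open>The cut at index 0 is always empty; it is included so that the maximum also makes sense
  for the graph without vertices.\<close>

definition cutwidth :: "'a set \<Rightarrow> 'a set set \<Rightarrow> (nat \<Rightarrow> 'a) \<Rightarrow> nat" where
  "cutwidth V E l = (MAX i\<in>{0..card V}. card (cut V E l i))"

definition bipartite :: "'a set \<Rightarrow> 'a set set \<Rightarrow> bool" where
  "bipartite V E \<longleftrightarrow>
    (\<exists>A B. A \<union> B = V \<and> A \<inter> B = {} \<and> (\<forall>e\<in>E. \<exists>a\<in>A. \<exists>b\<in>B. e = {a, b}))"

definition has_oct :: "'a set \<Rightarrow> 'a set set \<Rightarrow> nat \<Rightarrow> bool" where
  "has_oct V E k \<longleftrightarrow>
    (\<exists>S\<subseteq>V. card S \<le> k \<and> bipartite (V - S) {e \<in> E. e \<inter> S = {}})"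


section \<open>Machine model: random access programs with logarithmic cost\<close>

text \<open>
  The model is the random access machine with the logarithmic cost criterion: the memory holds
  natural numbers, addressing may be indirect, and every operation is charged the binary length
  of all the numbers and addresses it handles, so that no cost can be hidden in large numbers.
  Programs are structured (sequence, conditional, loop) instead of being lists of jumps,
  and the memory is divided into arrays with fixed names. A program mentions only finitely
  many names, so its arrays can be interleaved in a single memory; both conventions affect
  running times by constant factors only. A scalar variable is an array used at index 0 only.
\<close>

type_synonym vname = nat
type_synonym state = "vname \<Rightarrow> nat \<Rightarrow> nat"

text \<open>In \<open>Get x a\<close> the address is the value of \<open>a\<close>. Subtraction is truncated at 0, and division is
  integer division, with result 0 for divisor 0.\<close>

datatype aexp =
    Num nat
  | Get vname aexp
  | Add aexp aexp
  | Sub aexp aexp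
  | Mul aexp aexp
  | Div aexp aexp

datatype bexp =
    Less aexp aexp
  | Eq aexp aexp
  | Neg bexp
  | Conj bexp bexp

text \<open>\<open>Put x a e\<close> stores the value of \<open>e\<close> in array \<open>x\<close> at the address given by the value of \<open>a\<close>.\<close>

datatype com =
    Skip
  | Put vname aexp aexp
  | Seq com com
  | If bexp com com
  | While bexp com

text \<open>Binary length of a number, plus 1 so that no operation is free.\<close>

definition len :: "nat \<Rightarrow> nat" where
  "len x = 1 + floorlog 2 x"

fun aval :: "aexp \<Rightarrow> state \<Rightarrow> nat" where
  "aval (Num n) s = n"
| "aval (Get x a) s = s x (aval a s)"
| "aval (Add a b) s = aval a s + aval b s"
| "aval (Sub a b) s = aval a s - aval b s"
| "aval (Mul a b) s = aval a s * aval b s"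
| "aval (Div a b) s = aval a s div aval b s"

fun acost :: "aexp \<Rightarrow> state \<Rightarrow> nat" where
  "acost (Num n) s = len n"
| "acost (Get x a) s = acost a s + len (aval a s) + len (s x (aval a s))"
| "acost (Add a b) s = acost a s + acost b s + len (aval a s) + len (aval b s)"
| "acost (Sub a b) s = acost a s + acost b s + len (aval a s) + len (aval b s)"
| "acost (Mul a b) s = acost a s + acost b s + len (aval a s) + len (aval b s)"
| "acost (Div a b) s = acost a s + acost b s + len (aval a s) + len (aval b s)"

fun bval :: "bexp \<Rightarrow> state \<Rightarrow> bool" where
  "bval (Less a b) s \<longleftrightarrow> aval a s < aval b s"
| "bval (Eq a b) s \<longleftrightarrow> aval a s = aval b s"
| "bval (Neg b) s \<longleftrightarrow> \<not> bval b s"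
| "bval (Conj b c) s \<longleftrightarrow> bval b s \<and> bval c s"

fun bcost :: "bexp \<Rightarrow> state \<Rightarrow> nat" where
  "bcost (Less a b) s = acost a s + acost b s + len (aval a s) + len (aval b s)"
| "bcost (Eq a b) s = acost a s + acost b s + len (aval a s) + len (aval b s)"
| "bcost (Neg b) s = bcost b s + 1"
| "bcost (Conj b c) s = bcost b s + bcost c s + 1"

definition put :: "state \<Rightarrow> vname \<Rightarrow> nat \<Rightarrow> nat \<Rightarrow> state" where
  "put s x i v = s(x := (s x)(i := v))"

text \<open>\<open>exec c s t s'\<close>: started in \<open>s\<close>, the program \<open>c\<close> halts in \<open>s'\<close> after time \<open>t\<close>.\<close>

inductive exec :: "com \<Rightarrow> state \<Rightarrow> nat \<Rightarrow> state \<Rightarrow> bool" where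
  Skip: "exec Skip s 1 s"
| Put: "exec (Put x a e) s
    (acost a s + acost e s + len (aval a s) + len (aval e s)) (put s x (aval a s) (aval e s))"
| Seq: "exec c1 s1 t1 s2 \<Longrightarrow> exec c2 s2 t2 s3 \<Longrightarrow> exec (Seq c1 c2) s1 (t1 + t2) s3"
| IfTrue: "bval b s \<Longrightarrow> exec c1 s t s' \<Longrightarrow> exec (If b c1 c2) s (bcost b s + t + 1) s'"
| IfFalse: "\<not> bval b s \<Longrightarrow> exec c2 s t s' \<Longrightarrow> exec (If b c1 c2) s (bcost b s + t + 1) s'"
| WhileFalse: "\<not> bval b s \<Longrightarrow> exec (While b c) s (bcost b s + 1) s"
| WhileTrue: "bval b s1 \<Longrightarrow> exec c s1 t1 s2 \<Longrightarrow> exec (While b c) s2 t2 s3 \<Longrightarrow>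
    exec (While b c) s1 (bcost b s1 + t1 + t2 + 1) s3"

lemma exec_deterministic:
  "exec c s t s' \<Longrightarrow> exec c s u r \<Longrightarrow> u = t \<and> r = s'"
proof (induction arbitrary: u r rule: exec.induct)
  case (Skip s)
  then show ?case by (cases rule: exec.cases) simp_all
next
  case (Put x a e s)
  then show ?case by (cases rule: exec.cases) simp_all
next
  case (Seq c1 s1 t1 s2 c2 t2 s3)
  from Seq.prems show ?case
    by (cases rule: exec.cases) (use Seq.IH in force)
next
  case (IfTrue b s c1 t s' c2)
  from IfTrue.prems show ?case
    by (cases rule: exec.cases) (use IfTrue.hyps IfTrue.IH in force)+
next
  case (IfFalse b s c2 t s' c1)
  from IfFalse.prems show ?case
    by (cases rule: exec.cases) (use IfFalse.hyps IfFalse.IH in force)+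
next
  case (WhileFalse b s c)
  from WhileFalse.prems show ?case
    by (cases rule: exec.cases) (use WhileFalse.hyps in simp_all)
next
  case (WhileTrue b s1 c t1 s2 t2 s3)
  from WhileTrue.prems show ?case
    by (cases rule: exec.cases) (use WhileTrue.hyps WhileTrue.IH in force)+
qed

text \<open>The input is a list of numbers, stored in array 0; all other memory cells are initially 0.
  The output is expected in array 1 at index 0.\<close>

definition init :: "nat list \<Rightarrow> state" where
  "init xs = (\<lambda>x i. if x = 0 \<and> i < length xs then xs ! i else 0)"

definition result :: "state \<Rightarrow> nat" where
  "result s = s 1 0"

definition input_size :: "nat list \<Rightarrow> nat" where
  "input_size xs = (\<Sum>x\<leftarrow>xs. len x)"


section \<open>Instances as inputs\<close>

text \<open>Vertices are named by arbitrary natural numbers. An input lists the number of vertices,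
  the number of edges, \<open>k\<close>, the vertices in the order of the arrangement, and then the two ends
  of each edge. Edges come once each, in any order, and with their ends in any order.\<close>

definition encodes :: "nat list \<Rightarrow> nat set \<Rightarrow> nat set set \<Rightarrow> (nat \<Rightarrow> nat) \<Rightarrow> nat \<Rightarrow> bool" where
  "encodes xs V E l k \<longleftrightarrow>
    (\<exists>es. distinct (map (\<lambda>(u, v). {u, v}) es) \<and> set (map (\<lambda>(u, v). {u, v}) es) = E \<and>
      xs = [card V, length es, k] @ map l [1..<card V + 1] @ concat (map (\<lambda>(u, v). [u, v]) es))"

lemma encodes_exists:
  assumes "simple_graph V E"
  shows "\<exists>xs. encodes xs V E l k"
proof -
  have "E \<subseteq> Pow V" "finite V"
    using assms by (auto simp: simple_graph_def)
  then have "finite E" by (meson finite_Pow_iff finite_subset)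
  then obtain Es where Es: "set Es = E" "distinct Es"
    using finite_distinct_list by blast
  have "\<forall>e\<in>E. \<exists>p. (\<lambda>(u, v). {u, v}) p = e"
    using assms by (fastforce simp: simple_graph_def)
  then obtain f where f: "\<And>e. e \<in> E \<Longrightarrow> (\<lambda>(u, v). {u, v}) (f e) = e" by metis
  have "map (\<lambda>(u, v). {u, v}) (map f Es) = Es"
    unfolding map_map by (rule map_idI) (use f Es(1) in auto)
  with Es show ?thesis
    unfolding encodes_def by metis
qed

end

(*
  Choose for every edge which of its ends is coloured True, and charge 1 for each vertex about which
  its incident edges disagree. Deleting the charged vertices leaves a properly 2-coloured graph, and
  an odd cycle transversal with its 2-colouring yields such a choice with at most |S| charges, so the
  least charge is the size of a smallest odd cycle transversal. The choice is binary per edge, hence a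
  dynamic program along the arrangement needs only 2^|E_i| states at cut i, instead of three states
  per vertex. To stay within this bound while passing from one cut to the next, the edges that end at
  the next vertex are forgotten one at a time before those that start there are introduced, with a
  separate table for each of the two possible colours of that vertex.
*)

theory Submission
  imports Defs "HOL-Library.Nat_Bijection"
begin

section \<open>Time bounds for structured programs\<close>

text \<open>A vertex is charged at most 1 however many of its edges disagree, so the charge for a
  fixed colour saturates: once one edge contradicts the colour, the cost is one more than the number
  of conflicts at earlier vertices, whatever the other edges say. The recurrences for the two colour
  tables therefore fall back on the plain conflict count, which is carried as a third table through
  every change of the edge set. Logarithmic cost is handled by a word length \<open>K\<close>: while
  every cell stays below \<open>2 ^ K\<close>, an atomic step costs at most a constant, read off
  from the program text, times \<open>K\<close>, and only loop iterations remain to be counted. In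
  return each store must be shown to keep its value below \<open>2 ^ K\<close>. Masks of
  \<open>m\<close> edges fit because \<open>m < K\<close>, and conflict counts because they never
  exceed the number of vertices. Addresses may be exponentially large; an access then costs linearly
  many bits, while the time depends only on the cells visited.\<close>

fun width :: "aexp \<Rightarrow> nat" where
  "width (Num n) = Suc n"
| "width (Get x a) = 1"
| "width (Add a b) = width a + width b"
| "width (Sub a b) = width a + width b"
| "width (Mul a b) = width a + width b"
| "width (Div a b) = width a + width b"

fun aweight :: "aexp \<Rightarrow> nat" where
  "aweight (Num n) = Suc (width (Num n))"
| "aweight (Get x a) = aweight a + Suc (width a) + 2"
| "aweight (Add a b) = aweight a + aweight b + Suc (width a) + Suc (width b)"
| "aweight (Sub a b) = aweight a + aweight b + Suc (width a) + Suc (width b)"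
| "aweight (Mul a b) = aweight a + aweight b + Suc (width a) + Suc (width b)"
| "aweight (Div a b) = aweight a + aweight b + Suc (width a) + Suc (width b)"

fun bweight :: "bexp \<Rightarrow> nat" where
  "bweight (Less a b) = aweight a + aweight b + Suc (width a) + Suc (width b)"
| "bweight (Eq a b) = aweight a + aweight b + Suc (width a) + Suc (width b)"
| "bweight (Neg b) = bweight b + 1"
| "bweight (Conj b c) = bweight b + bweight c + 1"

text \<open>Depends on the program text alone: a loop body is counted once, and its repetitions are
  left to the factor \<open>X\<close> of \<open>run\<close>. A conditional simply adds both
  branches.\<close>

fun weight :: "com \<Rightarrow> nat" where
  "weight Skip = 1"
| "weight (Put x a e) = aweight a + aweight e + Suc (width a) + Suc (width e)"
| "weight (Seq c d) = weight c + weight d"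
| "weight (If b c d) = bweight b + weight c + weight d + 1"
| "weight (While b c) = bweight b + weight c + 1"

fun writes :: "com \<Rightarrow> vname set" where
  "writes Skip = {}"
| "writes (Put x a e) = {x}"
| "writes (Seq c d) = writes c \<union> writes d"
| "writes (If b c d) = writes c \<union> writes d"
| "writes (While b c) = writes c"

text \<open>\<open>0 < K\<close> lets the unit charges of the cost model be absorbed into multiples
  of \<open>K\<close>.\<close>

definition small :: "nat \<Rightarrow> state \<Rightarrow> bool" where
  "small K s \<longleftrightarrow> 0 < K \<and> (\<forall>x i. s x i < 2 ^ K)"

lemma smallD: "small K s \<Longrightarrow> s x i < 2 ^ K"
  by (simp add: small_def)

lemma width_pos: "0 < width a"
  by (induction a) auto

text \<open>Both powers are at least 2, and the sum of two such numbers is at most their product.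
  Hence exponents may be added for sums just as for products.\<close>

lemma add_less_power2:
  fixes x y :: nat
  assumes "x < 2 ^ p" "y < 2 ^ q" "0 < p" "0 < q"
  shows "x + y < 2 ^ (p + q)"
proof -
  have "(2::nat) \<le> 2 ^ p" "(2::nat) \<le> 2 ^ q"
    using assms by (simp_all add: self_le_power)
  then obtain a b where "2 ^ p = 2 + (a::nat)" "2 ^ q = 2 + (b::nat)"
    using le_Suc_ex by metis
  then show ?thesis
    using assms by (simp add: power_add algebra_simps)
qed

text \<open>Sums and products add the widths of their operands, and truncated subtraction and
  division never exceed the first operand. A constant gets the crude width \<open>Suc n\<close>,
  which is harmless because it is fixed by the program.\<close>

lemma aval_less:
  assumes "small K s"
  shows "aval a s < 2 ^ (width a * K)"
proof (induction a)
  case (Num n)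
  have "n < 2 ^ Suc n"
    using less_exp[of "Suc n"] by linarith
  also have "\<dots> \<le> 2 ^ (Suc n * K)"
    using assms mult_le_mono2[of 1 K "Suc n"] by (intro power_increasing) (auto simp: small_def)
  finally show ?case by simp
next
  case (Get x a)
  then show ?case using assms by (simp add: small_def)
next
  case (Add a b)
  then show ?case
    using add_less_power2[of _ "width a * K" _ "width b * K"] assms width_pos
    by (simp add: small_def add_mult_distrib)
next
  case (Sub a b)
  have "(2::nat) ^ (width a * K) \<le> 2 ^ (width (Sub a b) * K)"
    by (intro power_increasing) auto
  with Sub.IH(1) show ?case
    by (simp only: aval.simps)
next
  case (Mul a b)
  then show ?case
    by (simp add: add_mult_distrib power_add mult_strict_mono)
next
  case (Div a b)
  have "(2::nat) ^ (width a * K) \<le> 2 ^ (width (Div a b) * K)"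
    by (intro power_increasing) auto
  moreover have "aval a s div aval b s \<le> aval a s"
    by simp
  ultimately show ?case
    using Div.IH(1) by (simp only: aval.simps)
qed

lemma len_le:
  assumes "0 < K" "x < 2 ^ (w * K)"
  shows "len x \<le> Suc w * K"
proof -
  have "floorlog 2 x \<le> w * K"
    using assms by (simp add: floorlog_le_iff)
  then show ?thesis
    using assms by (simp add: len_def)
qed

lemma len_aval:
  assumes "small K s"
  shows "len (aval a s) \<le> Suc (width a) * K"
  by (rule len_le) (use assms aval_less in \<open>auto simp: small_def\<close>)

lemma len_cell:
  assumes "small K s"
  shows "len (s x i) \<le> 2 * K"
  using len_le[of K "s x i" 1] assms by (simp add: small_def)

lemma acost_le:
  assumes "small K s"
  shows "acost a s \<le> aweight a * K"
proof (induction a)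
  case (Num n)
  then show ?case using len_aval[OF assms, of "Num n"] by simp
next
  case (Get x a)
  then show ?case
    using len_aval[OF assms, of a] len_cell[OF assms, of x "aval a s"]
    by (simp add: algebra_simps)
next
  case (Add a b)
  then show ?case
    using len_aval[OF assms, of a] len_aval[OF assms, of b] by (simp add: algebra_simps)
next
  case (Sub a b)
  then show ?case
    using len_aval[OF assms, of a] len_aval[OF assms, of b] by (simp add: algebra_simps)
next
  case (Mul a b)
  then show ?case
    using len_aval[OF assms, of a] len_aval[OF assms, of b] by (simp add: algebra_simps)
next
  case (Div a b)
  then show ?case
    using len_aval[OF assms, of a] len_aval[OF assms, of b] by (simp add: algebra_simps)
qed

lemma bcost_le:
  assumes "small K s"
  shows "bcost b s \<le> bweight b * K"
proof (induction b)
  case (Less a b)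
  then show ?case
    using acost_le[OF assms, of a] acost_le[OF assms, of b]
      len_aval[OF assms, of a] len_aval[OF assms, of b] by (simp add: algebra_simps)
next
  case (Eq a b)
  then show ?case
    using acost_le[OF assms, of a] acost_le[OF assms, of b]
      len_aval[OF assms, of a] len_aval[OF assms, of b] by (simp add: algebra_simps)
next
  case (Neg b)
  then show ?case using assms by (simp add: small_def)
next
  case (Conj b c)
  then show ?case using assms by (simp add: small_def algebra_simps)
qed

section \<open>Total correctness together with running time\<close>

lemma put_apply: "put s x i v y j = (if y = x \<and> j = i then v else s y j)"
  by (simp add: put_def)

lemma put_other: "y \<noteq> x \<Longrightarrow> put s x i v y = s y"
  by (simp add: put_def)

lemma put_array: "put s x i v y = (if y = x then (s x)(i := v) else s y)"
  by (simp add: put_def)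

lemma exec_frame: "exec c s t s' \<Longrightarrow> x \<notin> writes c \<Longrightarrow> s' x = s x"
  by (induction rule: exec.induct) (auto simp: put_other)

text \<open>\<open>X\<close> bounds the number of times that any atomic step of \<open>c\<close> is executed.\<close>

definition run :: "nat \<Rightarrow> nat \<Rightarrow> com \<Rightarrow> state \<Rightarrow> (state \<Rightarrow> bool) \<Rightarrow> bool" where
  "run K X c s Q \<longleftrightarrow> (small K s \<longrightarrow>
    (\<exists>t s'. exec c s t s' \<and> t \<le> weight c * X * K \<and> small K s' \<and> Q s'))"

lemma run_smallI: "(small K s \<Longrightarrow> run K X c s Q) \<Longrightarrow> run K X c s Q"
  by (simp add: run_def)

text \<open>The new postcondition may use that arrays outside \<open>writes c\<close> are unchanged,
  so invariants need not list what a program leaves alone.\<close>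

lemma run_mono:
  assumes "run K X c s Q" "X \<le> Y"
    and "\<And>s'. Q s' \<Longrightarrow> (\<And>x. x \<notin> writes c \<Longrightarrow> s' x = s x) \<Longrightarrow> Q' s'"
  shows "run K Y c s Q'"
  unfolding run_def
proof
  assume "small K s"
  then obtain t s' where *: "exec c s t s'" "t \<le> weight c * X * K" "small K s'" "Q s'"
    using assms(1) by (auto simp: run_def)
  have "weight c * X * K \<le> weight c * Y * K"
    using assms(2) by (intro mult_right_mono mult_left_mono) auto
  then show "\<exists>t s'. exec c s t s' \<and> t \<le> weight c * Y * K \<and> small K s' \<and> Q' s'"
    using * assms(3) exec_frame by (meson le_trans)
qed

lemma mult_le_insert:
  fixes w X K :: nat
  shows "0 < X \<Longrightarrow> w * K \<le> w * X * K"
  by simp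

lemma run_skip:
  assumes "0 < X" "Q s"
  shows "run K X Skip s Q"
  unfolding run_def
proof
  assume "small K s"
  then have "1 \<le> X * K"
    using assms by (simp add: small_def Suc_le_eq)
  with exec.Skip[of s] assms \<open>small K s\<close>
  show "\<exists>t s'. exec Skip s t s' \<and> t \<le> weight Skip * X * K \<and> small K s' \<and> Q s'"
    by (metis weight.simps(1) mult_1)
qed

lemma run_put:
  assumes "0 < X" "small K s \<Longrightarrow> aval e s < 2 ^ K" "Q (put s x (aval a s) (aval e s))"
  shows "run K X (Put x a e) s Q"
  unfolding run_def
proof
  assume s: "small K s"
  have "acost a s + acost e s + len (aval a s) + len (aval e s) \<le> weight (Put x a e) * K"
    using acost_le[OF s, of a] acost_le[OF s, of e] len_aval[OF s, of a] len_aval[OF s, of e]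
    by (simp add: algebra_simps)
  also have "\<dots> \<le> weight (Put x a e) * X * K"
    by (rule mult_le_insert[OF assms(1)])
  finally have "acost a s + acost e s + len (aval a s) + len (aval e s) \<le> weight (Put x a e) * X * K" .
  moreover have "small K (put s x (aval a s) (aval e s))"
    using s assms(2) by (auto simp: small_def put_apply)
  ultimately show "\<exists>t s'. exec (Put x a e) s t s' \<and> t \<le> weight (Put x a e) * X * K \<and> small K s' \<and> Q s'"
    using exec.Put assms(3) by blast
qed

text \<open>Both parts share one \<open>X\<close>, because it bounds repetitions of a single step;
  the sizes of the parts add up in \<open>weight\<close>.\<close>

lemma run_seq:
  assumes "run K X c s (\<lambda>s'. run K X d s' Q)"
  shows "run K X (Seq c d) s Q"
  unfolding run_def
proof
  assume "small K s"
  then obtain t s' where *: "exec c s t s'" "t \<le> weight c * X * K" "small K s'" "run K X d s' Q"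
    using assms by (auto simp: run_def)
  then obtain u s'' where "exec d s' u s''" "u \<le> weight d * X * K" "small K s''" "Q s''"
    by (auto simp: run_def)
  with * exec.Seq show "\<exists>t s'. exec (Seq c d) s t s' \<and> t \<le> weight (Seq c d) * X * K \<and> small K s' \<and> Q s'"
    by (fastforce simp: add_mult_distrib)
qed

lemma run_seq_frame:
  assumes "run K Y c s Q" "Y \<le> X"
    and "\<And>s'. Q s' \<Longrightarrow> (\<And>x. x \<notin> writes c \<Longrightarrow> s' x = s x) \<Longrightarrow> run K X d s' Q'"
  shows "run K X (Seq c d) s Q'"
  by (rule run_seq, rule run_mono[OF assms])

lemma run_if:
  assumes "0 < X" "bval b s \<Longrightarrow> run K X c s Q" "\<not> bval b s \<Longrightarrow> run K X d s Q"
  shows "run K X (If b c d) s Q"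
  unfolding run_def
proof
  assume s: "small K s"
  have "bcost b s + 1 \<le> (bweight b + 1) * K"
    using bcost_le[OF s, of b] s by (simp add: small_def)
  also have "\<dots> \<le> (bweight b + 1) * X * K"
    by (rule mult_le_insert[OF assms(1)])
  finally have b: "bcost b s + 1 \<le> (bweight b + 1) * X * K" .
  show "\<exists>t s'. exec (If b c d) s t s' \<and> t \<le> weight (If b c d) * X * K \<and> small K s' \<and> Q s'"
  proof (cases "bval b s")
    case True
    then obtain t s' where t: "exec c s t s'" "t \<le> weight c * X * K" "small K s'" "Q s'"
      using assms(2) s by (auto simp: run_def)
    have "bcost b s + t + 1 \<le> weight (If b c d) * X * K"
      using b t(2) by (simp add: add_mult_distrib)
    then show ?thesis
      using t exec.IfTrue[OF True t(1)] by blast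
  next
    case False
    then obtain t s' where t: "exec d s t s'" "t \<le> weight d * X * K" "small K s'" "Q s'"
      using assms(3) s by (auto simp: run_def)
    have "bcost b s + t + 1 \<le> weight (If b c d) * X * K"
      using b t(2) by (simp add: add_mult_distrib)
    then show ?thesis
      using t exec.IfFalse[OF False t(1)] by blast
  qed
qed

text \<open>The number \<open>n\<close> of passes is fixed beforehand, so termination comes with the
  time bound. The factor is \<open>Suc n\<close> because the guard is evaluated once more than the
  body.\<close>

lemma run_while:
  assumes "I 0 s"
    and step: "\<And>k s'. k < n \<Longrightarrow> I k s' \<Longrightarrow> (\<And>x. x \<notin> writes c \<Longrightarrow> s' x = s x) \<Longrightarrow>
      bval b s' \<and> run K Y c s' (I (Suc k))"
    and stop: "\<And>s'. I n s' \<Longrightarrow> (\<And>x. x \<notin> writes c \<Longrightarrow> s' x = s x) \<Longrightarrow> \<not> bval b s'"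
    and X: "Suc n * Y \<le> X" "0 < Y"
  shows "run K X (While b c) s (I n)"
  unfolding run_def
proof
  define B where "B = (bweight b + 1) * K"
  have b: "bcost b s' + 1 \<le> B" if "small K s'" for s'
    using bcost_le[OF that, of b] that by (simp add: small_def B_def)
  \<comment> \<open>Induction on the number \<open>d\<close> of passes still to come; the final
    \<open>B\<close> pays for the failing guard.\<close>
  have loop: "\<exists>t s''. exec (While b c) s' t s'' \<and> t \<le> d * (B + weight c * Y * K) + B \<and>
      small K s'' \<and> I n s''"
    if "k + d = n" "I k s'" "\<And>x. x \<notin> writes c \<Longrightarrow> s' x = s x" "small K s'" for k d s'
    using that
  proof (induction d arbitrary: k s')
    case 0
    then show ?case
      using exec.WhileFalse[of b s' c] stop[of s'] b[of s'] by auto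
  next
    case (Suc d)
    then have body: "bval b s'" "run K Y c s' (I (Suc k))"
      using step[of k s'] by auto
    then obtain t s1 where t: "exec c s' t s1" "t \<le> weight c * Y * K" "small K s1" "I (Suc k) s1"
      using Suc.prems by (auto simp: run_def)
    have "s1 x = s x" if "x \<notin> writes c" for x
      using exec_frame[OF t(1) that] Suc.prems(3) that by simp
    then obtain u s2 where u: "exec (While b c) s1 u s2" "u \<le> d * (B + weight c * Y * K) + B"
      "small K s2" "I n s2"
      using Suc.IH[of "Suc k" s1] Suc.prems(1) t by auto
    have "bcost b s' + t + u + 1 \<le> Suc d * (B + weight c * Y * K) + B"
      using b[OF Suc.prems(4)] t(2) u(2) by simp
    then show ?case
      using exec.WhileTrue[OF body(1) t(1) u(1)] u by blast
  qed
  assume "small K s"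
  then obtain t s' where t: "exec (While b c) s t s'" "t \<le> n * (B + weight c * Y * K) + B"
    "small K s'" "I n s'"
    using loop[of 0 n s] assms(1) by auto
  \<comment> \<open>The guard is overcharged by the factor \<open>Y\<close>, so that guard and body
    share the factor \<open>Suc n * Y\<close>.\<close>
  have "B \<le> B * Y"
    using X by simp
  then have "n * (B + weight c * Y * K) + B \<le> n * (B * Y + weight c * Y * K) + B * Y"
    by (intro add_mono mult_left_mono) auto
  also have "\<dots> \<le> weight (While b c) * (Suc n * Y) * K"
    by (simp add: B_def algebra_simps)
  also have "\<dots> \<le> weight (While b c) * X * K"
    using X by (intro mult_right_mono mult_left_mono) auto
  finally show "\<exists>t s'. exec (While b c) s t s' \<and> t \<le> weight (While b c) * X * K \<and> small K s' \<and> I n s'"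
    using t by (meson le_trans)
qed

section \<open>Counting loops\<close>

abbreviation Var :: "vname \<Rightarrow> aexp" where
  "Var x \<equiv> Get x (Num 0)"

definition For :: "vname \<Rightarrow> aexp \<Rightarrow> com \<Rightarrow> com" where
  "For v e c = Seq (Put v (Num 0) (Num 0))
    (While (Less (Var v) e) (Seq c (Put v (Num 0) (Add (Var v) (Num 1)))))"

lemma writes_For [simp]: "writes (For v e c) = insert v (writes c)"
  by (auto simp: For_def)

text \<open>The bound \<open>e\<close> is evaluated anew before every pass, so its value must be
  stable under everything the body writes. The invariant refers to the state after the counter has
  been increased, and \<open>n < 2 ^ K\<close> keeps the counter small.\<close>

lemma run_for:
  assumes n: "n < 2 ^ K" and v: "v \<notin> writes c"
    and "I 0 (put s v 0 0)"
    and step: "\<And>k s'. k < n \<Longrightarrow> I k s' \<Longrightarrow> s' v 0 = k \<Longrightarrow>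
      (\<And>x. x \<noteq> v \<Longrightarrow> x \<notin> writes c \<Longrightarrow> s' x = s x) \<Longrightarrow>
      run K Y c s' (\<lambda>s''. I (Suc k) (put s'' v 0 (Suc k)))"
    and bound: "\<And>k s'. k \<le> n \<Longrightarrow> (\<And>x. x \<noteq> v \<Longrightarrow> x \<notin> writes c \<Longrightarrow> s' x = s x) \<Longrightarrow>
      s' v 0 = k \<Longrightarrow> aval e s' = n"
    and X: "Suc n * Y \<le> X" "0 < Y"
  shows "run K X (For v e c) s (I n)"
  unfolding For_def
proof (rule run_seq_frame[where Y = X])
  show "run K X (Put v (Num 0) (Num 0)) s (\<lambda>s'. s' = put s v 0 0)"
    using X by (intro run_put) (auto intro: Nat.gr0I)
  let ?body = "Seq c (Put v (Num 0) (Add (Var v) (Num 1)))"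
  fix s' assume s': "s' = put s v 0 0"
  show "run K X (While (Less (Var v) e) ?body) s' (I n)"
  proof (rule run_mono[where Q = "\<lambda>s'. I n s' \<and> s' v 0 = n"])
    show "run K X (While (Less (Var v) e) ?body) s' (\<lambda>s'. I n s' \<and> s' v 0 = n)"
    proof (rule run_while[where I = "\<lambda>k s'. I k s' \<and> s' v 0 = k" and Y = Y])
      fix k r assume k: "k < n" "I k r \<and> r v 0 = k" "\<And>x. x \<notin> writes ?body \<Longrightarrow> r x = s' x"
      then have frame: "r x = s x" if "x \<noteq> v" "x \<notin> writes c" for x
        using that s' by (simp add: put_other)
      have "run K Y ?body r (\<lambda>s'. I (Suc k) s' \<and> s' v 0 = Suc k)"
      proof (rule run_seq_frame)
        show "run K Y c r (\<lambda>s''. I (Suc k) (put s'' v 0 (Suc k)))"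
          using step[of k r] k frame by blast
        fix q assume "I (Suc k) (put q v 0 (Suc k))" "\<And>x. x \<notin> writes c \<Longrightarrow> q x = r x"
        then show "run K Y (Put v (Num 0) (Add (Var v) (Num 1))) q (\<lambda>s'. I (Suc k) s' \<and> s' v 0 = Suc k)"
          using X k n v by (intro run_put) (auto simp: put_apply)
      qed simp
      then show "bval (Less (Var v) e) r \<and> run K Y ?body r (\<lambda>s'. I (Suc k) s' \<and> s' v 0 = Suc k)"
        using bound[of k r] k frame by auto
    next
      fix r assume "I n r \<and> r v 0 = n" "\<And>x. x \<notin> writes ?body \<Longrightarrow> r x = s' x"
      then show "\<not> bval (Less (Var v) e) r"
        using bound[of n r] s' by (simp add: put_other)
    qed (use assms s' in \<open>auto simp: put_apply\<close>)
  qed auto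
qed simp

section \<open>Odd cycle transversals as edge labellings\<close>

locale arranged_edges =
  fixes n m :: nat and lf rt :: "nat \<Rightarrow> nat"
  assumes lf_pos: "j < m \<Longrightarrow> 0 < lf j"
    and lf_less_rt: "j < m \<Longrightarrow> lf j < rt j"
    and rt_le: "j < m \<Longrightarrow> rt j \<le> n"
begin

text \<open>A set \<open>x\<close> of edges stands for a colouring of the left ends: the edges in \<open>x\<close> claim that their
  left end has colour \<open>True\<close> and their right end has colour \<open>False\<close>, the others claim the opposite.
  A vertex survives exactly if all claims about it agree.\<close>

definition claim :: "nat \<Rightarrow> nat set \<Rightarrow> nat \<Rightarrow> bool" where
  "claim i x j \<longleftrightarrow> (if lf j = i then j \<in> x else j \<notin> x)"

definition inc :: "nat \<Rightarrow> nat set" where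
  "inc i = {j. j < m \<and> (lf j = i \<or> rt j = i)}"

definition agree :: "bool \<Rightarrow> nat set \<Rightarrow> nat \<Rightarrow> nat set \<Rightarrow> bool" where
  "agree c P i x \<longleftrightarrow> (\<forall>j\<in>P. claim i x j = c)"

definition conflicted :: "nat set \<Rightarrow> nat \<Rightarrow> bool" where
  "conflicted x v \<longleftrightarrow> \<not> agree True (inc v) v x \<and> \<not> agree False (inc v) v x"

definition conflicts :: "nat \<Rightarrow> nat set \<Rightarrow> nat" where
  "conflicts i x = card {v \<in> {1..i}. conflicted x v}"

text \<open>The number of conflicts once vertex \<open>i + 1\<close>, of which only the edges in \<open>P\<close> have been seen, is
  given colour \<open>c\<close>. A violated vertex counts as deleted, so no third state is needed.\<close>

definition pen :: "bool \<Rightarrow> nat set \<Rightarrow> nat \<Rightarrow> nat set \<Rightarrow> nat" where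
  "pen c P i x = conflicts i x + (if agree c P (Suc i) x then 0 else 1)"

text \<open>The minimum ranges over labellings of all edges, forgotten and future ones included;
  only the trace on \<open>A\<close> is prescribed. Each table update thereby becomes an identity
  between minima, with no notion of partial solution. Future edges do no harm because conflict
  counts ignore them.\<close>

definition least :: "(nat set \<Rightarrow> nat) \<Rightarrow> nat set \<Rightarrow> nat set \<Rightarrow> nat" where
  "least f A y = Min (f ` {x. x \<subseteq> {..<m} \<and> x \<inter> A = y})"

definition active :: "nat \<Rightarrow> nat set" where
  "active i = {j. j < m \<and> lf j \<le> i \<and> i < rt j}"

section \<open>Minima over all labellings with a given trace\<close>

lemma finite_ext [simp]: "finite {x. x \<subseteq> {..<m} \<and> x \<inter> A = y}"
  by (rule finite_subset[of _ "Pow {..<m}"]) auto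

lemma ext_nonempty:
  assumes "A \<subseteq> {..<m}" "y \<subseteq> A"
  shows "{x. x \<subseteq> {..<m} \<and> x \<inter> A = y} \<noteq> {}"
proof -
  have "y \<subseteq> {..<m} \<and> y \<inter> A = y"
    using assms by auto
  then show ?thesis by blast
qed

lemma least_cong:
  "(\<And>x. x \<subseteq> {..<m} \<Longrightarrow> x \<inter> A = y \<Longrightarrow> f x = g x) \<Longrightarrow> least f A y = least g A y"
  unfolding least_def by (rule arg_cong[where f = Min], rule image_cong) auto

lemma least_le:
  assumes "A \<subseteq> {..<m}" "y \<subseteq> A" "\<And>x. f x \<le> b"
  shows "least f A y \<le> b"
  unfolding least_def using ext_nonempty[OF assms(1,2)] assms(3)
  by (subst Min_le_iff) auto

lemma least_Suc:
  assumes "A \<subseteq> {..<m}" "y \<subseteq> A"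
  shows "least (\<lambda>x. Suc (f x)) A y = Suc (least f A y)"
proof -
  have "Suc (Min (f ` {x. x \<subseteq> {..<m} \<and> x \<inter> A = y})) = Min (Suc ` f ` {x. x \<subseteq> {..<m} \<and> x \<inter> A = y})"
    using ext_nonempty[OF assms] by (intro mono_Min_commute) (auto simp: mono_def)
  then show ?thesis
    by (simp add: least_def image_image)
qed

text \<open>Choosing the colour of the current vertex commutes with choosing the labelling. This
  justifies a separate table for each colour.\<close>

lemma least_min:
  assumes "A \<subseteq> {..<m}" "y \<subseteq> A"
  shows "least (\<lambda>x. min (f x) (g x)) A y = min (least f A y) (least g A y)"
proof -
  let ?S = "{x. x \<subseteq> {..<m} \<and> x \<inter> A = y}"
  have ne: "?S \<noteq> {}" by (rule ext_nonempty[OF assms])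
  have "Min (f ` ?S) \<in> f ` ?S" "Min (g ` ?S) \<in> g ` ?S"
    using ne by (intro Min_in; simp)+
  then obtain a b where ab: "a \<in> ?S" "b \<in> ?S" "Min (f ` ?S) = f a" "Min (g ` ?S) = g b"
    by (metis (no_types, lifting) imageE)
  have le: "f a \<le> f x" "g b \<le> g x" if "x \<in> ?S" for x
    unfolding ab(3,4)[symmetric] using that by (intro Min_le; simp)+
  have "Min ((\<lambda>x. min (f x) (g x)) ` ?S) = min (f a) (g b)"
  proof (rule Min_eqI)
    show "min (f a) (g b) \<le> z" if z: "z \<in> (\<lambda>x. min (f x) (g x)) ` ?S" for z
    proof -
      from z obtain x where x: "x \<in> ?S" "z = min (f x) (g x)" by blast
      show ?thesis
        unfolding x(2) by (rule min.mono[OF le[OF x(1)]])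
    qed
    have "min (f a) (g b) = min (f a) (g a) \<or> min (f a) (g b) = min (f b) (g b)"
      using le(1)[OF ab(2)] le(2)[OF ab(1)] by linarith
    then show "min (f a) (g b) \<in> (\<lambda>x. min (f x) (g x)) ` ?S"
      using ab(1,2) by blast
  qed simp
  then show ?thesis
    by (simp add: least_def ab)
qed

text \<open>A labelling with trace \<open>y\<close> on \<open>A - {j}\<close> either contains
  \<open>j\<close> or does not.\<close>

lemma least_forget:
  assumes "j \<in> A" "A \<subseteq> {..<m}" "y \<subseteq> A - {j}"
  shows "least f (A - {j}) y = min (least f A y) (least f A (insert j y))"
proof -
  have "{x. x \<subseteq> {..<m} \<and> x \<inter> (A - {j}) = y} =
      {x. x \<subseteq> {..<m} \<and> x \<inter> A = y} \<union> {x. x \<subseteq> {..<m} \<and> x \<inter> A = insert j y}"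
    using assms by auto
  moreover have "{x. x \<subseteq> {..<m} \<and> x \<inter> A = y} \<noteq> {}" "{x. x \<subseteq> {..<m} \<and> x \<inter> A = insert j y} \<noteq> {}"
    using assms by (intro ext_nonempty; auto)+
  ultimately show ?thesis
    unfolding least_def by (simp add: image_Un Min_Un)
qed

text \<open>Toggling \<open>j\<close> does not change \<open>f\<close>, so prescribing whether
  \<open>j\<close> belongs to the labelling does not change the set of values attained.\<close>

lemma least_introduce:
  assumes "j \<notin> A" "j < m" "y \<subseteq> A" and f: "\<And>x. f (insert j x) = f (x - {j})"
  shows "least f (insert j A) y = least f A y" "least f (insert j A) (insert j y) = least f A y"
proof -
  have f': "f (insert j x) = f x" "f (x - {j}) = f x" for x
    using f[of x] by (cases "j \<in> x"; simp add: insert_absorb)+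
  have "f ` {x. x \<subseteq> {..<m} \<and> x \<inter> insert j A = y} = f ` {x. x \<subseteq> {..<m} \<and> x \<inter> A = y}"
  proof (intro equalityI image_subsetI)
    fix x assume "x \<in> {x. x \<subseteq> {..<m} \<and> x \<inter> A = y}"
    then have "x - {j} \<in> {x. x \<subseteq> {..<m} \<and> x \<inter> insert j A = y}"
      using assms by auto
    then show "f x \<in> f ` {x. x \<subseteq> {..<m} \<and> x \<inter> insert j A = y}"
      using f'(2)[of x] by (metis (no_types, lifting) image_eqI)
  qed (use assms(1-3) in auto)
  then show "least f (insert j A) y = least f A y"
    by (simp add: least_def)
  have "f ` {x. x \<subseteq> {..<m} \<and> x \<inter> insert j A = insert j y} = f ` {x. x \<subseteq> {..<m} \<and> x \<inter> A = y}"
  proof (intro equalityI image_subsetI)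
    fix x assume "x \<in> {x. x \<subseteq> {..<m} \<and> x \<inter> A = y}"
    then have "insert j x \<in> {x. x \<subseteq> {..<m} \<and> x \<inter> insert j A = insert j y}"
      using assms by auto
    then show "f x \<in> f ` {x. x \<subseteq> {..<m} \<and> x \<inter> insert j A = insert j y}"
      using f'(1)[of x] by (metis (no_types, lifting) image_eqI)
  next
    fix x assume "x \<in> {x. x \<subseteq> {..<m} \<and> x \<inter> insert j A = insert j y}"
    then have "x - {j} \<in> {x. x \<subseteq> {..<m} \<and> x \<inter> A = y}"
      using assms(1-3) by auto
    then show "f x \<in> f ` {x. x \<subseteq> {..<m} \<and> x \<inter> A = y}"
      using f'(2)[of x] by (metis (no_types, lifting) image_eqI)
  qed
  then show "least f (insert j A) (insert j y) = least f A y"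
    by (simp add: least_def)
qed

section \<open>Recurrences for conflicts and penalties\<close>

lemma conflicts_le: "conflicts i x \<le> i"
  unfolding conflicts_def
  by (rule order_trans[OF card_mono[of "{1..i}"]]) auto

text \<open>An edge incident to a vertex up to \<open>i\<close> has its left end there too, since
  the left end comes first. This is the independence from edges not yet introduced.\<close>

lemma conflicts_cong:
  assumes "\<And>j. j < m \<Longrightarrow> lf j \<le> i \<Longrightarrow> j \<in> x \<longleftrightarrow> j \<in> y"
  shows "conflicts i x = conflicts i y"
proof -
  have "agree c (inc v) v x = agree c (inc v) v y" if "v \<le> i" for c v
    unfolding agree_def inc_def claim_def
    using that assms lf_less_rt by (intro ball_cong) fastforce+
  then have "conflicted x v = conflicted y v" if "v \<le> i" for v
    using that by (simp add: conflicted_def)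
  then have "{v \<in> {1..i}. conflicted x v} = {v \<in> {1..i}. conflicted y v}"
    by auto
  then show ?thesis
    by (simp add: conflicts_def)
qed

text \<open>The new vertex is free of charge exactly if one of the two colours suits all its edges,
  so the better of the two penalties is the exact count.\<close>

lemma conflicts_Suc:
  "conflicts (Suc i) x = min (pen False (inc (Suc i)) i x) (pen True (inc (Suc i)) i x)"
proof -
  have "{v \<in> {1..Suc i}. conflicted x v} =
      {v \<in> {1..i}. conflicted x v} \<union> (if conflicted x (Suc i) then {Suc i} else {})"
    by (auto simp: le_Suc_eq)
  then have "conflicts (Suc i) x = conflicts i x + (if conflicted x (Suc i) then 1 else 0)"
    by (simp add: conflicts_def)
  then show ?thesis
    by (simp add: pen_def conflicted_def)
qed

lemma pen_empty: "pen c {} i = conflicts i"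
  by (auto simp: pen_def agree_def)

text \<open>Saturation: one contradicting edge already costs the full charge, and \<open>P\<close>
  drops out.\<close>

lemma pen_insert:
  "pen c (insert j P) i x = (if claim (Suc i) x j = c then pen c P i x else Suc (conflicts i x))"
  by (simp add: pen_def agree_def)

lemma least_conflicts_Suc:
  assumes "A \<subseteq> {..<m}" "y \<subseteq> A"
  shows "least (conflicts (Suc i)) A y =
    min (least (pen False (inc (Suc i)) i) A y) (least (pen True (inc (Suc i)) i) A y)"
  using least_min[OF assms] by (simp add: conflicts_Suc[abs_def])

text \<open>At its right end the edge claims \<open>True\<close> exactly if
  \<open>j \<notin> x\<close>. For either colour one of the two choices for \<open>j\<close> agrees
  and keeps the old penalty, and the other one is paid for from the conflict table.\<close>

lemma pen_forget:
  assumes "j \<in> A" "A \<subseteq> {..<m}" "y \<subseteq> A - {j}" "rt j = Suc i"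
  shows "least (pen c (insert j P) i) (A - {j}) y =
    min (least (pen c P i) A (if c then y else insert j y))
      (Suc (least (conflicts i) A (if c then insert j y else y)))"
proof -
  have "lf j \<noteq> Suc i"
    using assms lf_less_rt[of j] by auto
  then have claim: "claim (Suc i) x j \<longleftrightarrow> j \<notin> x" for x
    by (simp add: claim_def)
  have "least (pen c (insert j P) i) A (if c then y else insert j y) =
      least (pen c P i) A (if c then y else insert j y)"
    using assms by (intro least_cong) (auto simp: pen_insert claim split: if_splits)
  moreover have "least (pen c (insert j P) i) A (if c then insert j y else y) =
      least (\<lambda>x. Suc (conflicts i x)) A (if c then insert j y else y)"
    using assms by (intro least_cong) (auto simp: pen_insert claim split: if_splits)
  ultimately show ?thesis
    using assms by (simp add: least_forget least_Suc min.commute subset_Diff_insert split: if_splits)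
qed

lemma conflicts_introduce:
  assumes "j \<notin> A" "j < m" "y \<subseteq> A" "lf j = Suc i"
  shows "least (conflicts i) (insert j A) y = least (conflicts i) A y"
    "least (conflicts i) (insert j A) (insert j y) = least (conflicts i) A y"
  by (rule least_introduce[OF assms(1-3)]; rule conflicts_cong; use assms in auto)+

text \<open>At the left end the claim is \<open>True\<close> exactly if \<open>j \<in> x\<close>.
  The edge starts at \<open>Suc i\<close>, so \<open>conflicts i\<close> ignores it, and
  \<open>j \<notin> P\<close> makes the old penalty ignore it as well; only the claim of
  \<open>j\<close> itself tells the two choices apart.\<close>

lemma pen_introduce:
  assumes "j \<notin> A" "A \<subseteq> {..<m}" "j < m" "y \<subseteq> A" "lf j = Suc i" "j \<notin> P"
  shows "least (pen c (insert j P) i) (insert j A) (if c then insert j y else y) =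
      least (pen c P i) A y"
    "least (pen c (insert j P) i) (insert j A) (if c then y else insert j y) =
      Suc (least (conflicts i) A y)"
proof -
  have claim: "claim (Suc i) x j \<longleftrightarrow> j \<in> x" for x
    using assms by (simp add: claim_def)
  have indep: "pen c P i (insert j x) = pen c P i (x - {j})" for x
  proof -
    have "agree c P (Suc i) (insert j x) = agree c P (Suc i) (x - {j})"
      unfolding agree_def claim_def using assms(6) by (intro ball_cong) auto
    moreover have "conflicts i (insert j x) = conflicts i (x - {j})"
      using assms by (intro conflicts_cong) auto
    ultimately show ?thesis by (simp add: pen_def)
  qed
  have "least (pen c (insert j P) i) (insert j A) (if c then insert j y else y) =
      least (pen c P i) (insert j A) (if c then insert j y else y)"
    using assms by (intro least_cong) (auto simp: pen_insert claim split: if_splits)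
  then show "least (pen c (insert j P) i) (insert j A) (if c then insert j y else y) =
      least (pen c P i) A y"
    using least_introduce[of j A y "pen c P i", OF assms(1,3,4) indep] by (cases c) simp_all
  have "least (pen c (insert j P) i) (insert j A) (if c then y else insert j y) =
      least (\<lambda>x. Suc (conflicts i x)) (insert j A) (if c then y else insert j y)"
    using assms by (intro least_cong) (auto simp: pen_insert claim split: if_splits)
  also have "\<dots> = Suc (least (conflicts i) (insert j A) (if c then y else insert j y))"
    using assms by (intro least_Suc) auto
  finally show "least (pen c (insert j P) i) (insert j A) (if c then y else insert j y) =
      Suc (least (conflicts i) A y)"
    using assms by (simp add: conflicts_introduce)
qed

end

section \<open>Transversals of a graph versus labellings of its listed edges\<close>

locale arranged_graph =
  fixes V :: "nat set" and E :: "nat set set" and l :: "nat \<Rightarrow> nat" and es :: "(nat \<times> nat) list"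
  assumes graph: "simple_graph V E" and lin: "linear_arrangement V l"
    and dist: "distinct (map (\<lambda>(u, v). {u, v}) es)"
    and es: "set (map (\<lambda>(u, v). {u, v}) es) = E"
begin

definition pos :: "nat \<Rightarrow> nat" where
  "pos = inv_into {1..card V} l"

definition left_pos :: "nat \<Rightarrow> nat" where
  "left_pos j = min (pos (fst (es ! j))) (pos (snd (es ! j)))"

definition right_pos :: "nat \<Rightarrow> nat" where
  "right_pos j = max (pos (fst (es ! j))) (pos (snd (es ! j)))"

lemma bij: "bij_betw l {1..card V} V"
  using lin by (simp add: linear_arrangement_def)

lemma pos_range: "v \<in> V \<Longrightarrow> pos v \<in> {1..card V}"
  using bij by (metis bij_betw_imp_surj_on inv_into_into pos_def)

lemma l_pos: "v \<in> V \<Longrightarrow> l (pos v) = v"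
  using bij by (metis bij_betw_imp_surj_on f_inv_into_f pos_def)

lemma pos_l: "i \<in> {1..card V} \<Longrightarrow> pos (l i) = i"
  using bij by (metis bij_betw_imp_inj_on inv_into_f_f pos_def)

lemma l_in: "i \<in> {1..card V} \<Longrightarrow> l i \<in> V"
  using bij bij_betwE by blast

lemma edge_ends:
  assumes "j < length es"
  shows "fst (es ! j) \<in> V" "snd (es ! j) \<in> V" "fst (es ! j) \<noteq> snd (es ! j)"
    "{fst (es ! j), snd (es ! j)} \<in> E"
proof -
  have "(\<lambda>(u, v). {u, v}) (es ! j) \<in> set (map (\<lambda>(u, v). {u, v}) es)"
    using assms by auto
  then show *: "{fst (es ! j), snd (es ! j)} \<in> E"
    unfolding es by (simp add: case_prod_unfold)
  then obtain a b where "a \<in> V" "b \<in> V" "a \<noteq> b" "{fst (es ! j), snd (es ! j)} = {a, b}"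
    using graph unfolding simple_graph_def by blast
  then show "fst (es ! j) \<in> V" "snd (es ! j) \<in> V" "fst (es ! j) \<noteq> snd (es ! j)"
    by (auto simp: doubleton_eq_iff)
qed

lemma edge_by_pos:
  assumes "j < length es"
  shows "left_pos j \<in> {1..card V}" "right_pos j \<in> {1..card V}" "left_pos j < right_pos j"
    "{l (left_pos j), l (right_pos j)} = {fst (es ! j), snd (es ! j)}"
proof -
  have "pos (fst (es ! j)) \<noteq> pos (snd (es ! j))"
    using edge_ends[OF assms] l_pos by metis
  then show "left_pos j \<in> {1..card V}" "right_pos j \<in> {1..card V}" "left_pos j < right_pos j"
    "{l (left_pos j), l (right_pos j)} = {fst (es ! j), snd (es ! j)}"
    using edge_ends[OF assms] pos_range l_pos
    by (auto simp: left_pos_def right_pos_def min_def max_def)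
qed

lemma edge_index:
  assumes "e \<in> E"
  obtains j where "j < length es" "e = {l (left_pos j), l (right_pos j)}"
proof -
  from assms obtain j where "j < length es" "e = (\<lambda>(u, v). {u, v}) (es ! j)"
    unfolding es[symmetric] by (auto simp: in_set_conv_nth)
  then show thesis
    using that[of j] edge_by_pos(4)[of j] by (simp add: case_prod_unfold)
qed

sublocale arranged_edges "card V" "length es" left_pos right_pos
  by unfold_locales (use edge_by_pos in \<open>force simp: Suc_le_eq\<close>)+

text \<open>Indices map injectively to edges because no edge is listed twice. Beyond
  \<open>card V\<close> the maximum in \<open>cutwidth\<close> says nothing, but no edge reaches
  that far.\<close>

lemma card_active_le: "card (active i) \<le> cutwidth V E l"
proof (cases "i \<le> card V")
  case True
  let ?f = "\<lambda>j. {fst (es ! j), snd (es ! j)}"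
  have "inj_on ?f {..<length es}"
  proof (rule inj_onI)
    fix a b assume ab: "a \<in> {..<length es}" "b \<in> {..<length es}" "?f a = ?f b"
    then have "map (\<lambda>(u, v). {u, v}) es ! a = map (\<lambda>(u, v). {u, v}) es ! b"
      by (simp add: case_prod_unfold)
    then show "a = b"
      using ab dist by (simp only: nth_eq_iff_index_eq length_map lessThan_iff)
  qed
  then have inj: "inj_on ?f (active i)"
    by (rule inj_on_subset) (auto simp: active_def)
  have "?f ` active i \<subseteq> cut V E l i"
  proof
    fix e assume "e \<in> ?f ` active i"
    then obtain j where j: "j < length es" "left_pos j \<le> i" "i < right_pos j" "e = ?f j"
      by (auto simp: active_def)
    then show "e \<in> cut V E l i"
      using edge_by_pos[OF j(1)] edge_ends(4)[OF j(1)] unfolding cut_def by blast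
  qed
  moreover have "finite E"
    using es by (metis List.finite_set)
  then have "finite (cut V E l i)"
    by (simp add: cut_def)
  ultimately have "card (active i) \<le> card (cut V E l i)"
    using card_inj_on_le[OF inj] by blast
  also have "\<dots> \<le> cutwidth V E l"
    unfolding cutwidth_def using True by (intro Max_ge) auto
  finally show ?thesis .
next
  case False
  then have "active i = {}"
    using edge_by_pos(2) by (fastforce simp: active_def)
  then show ?thesis by simp
qed

lemma agree_left: "j < length es \<Longrightarrow> agree c (inc (left_pos j)) (left_pos j) x \<Longrightarrow> (j \<in> x) = c"
  by (auto simp: agree_def inc_def claim_def)

lemma agree_right: "j < length es \<Longrightarrow> agree c (inc (right_pos j)) (right_pos j) x \<Longrightarrow> (j \<notin> x) = c"
  using edge_by_pos(3)[of j] by (fastforce simp: agree_def inc_def claim_def)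

text \<open>Delete the conflicted vertices. At a surviving edge both ends are unanimous, so
  \<open>j \<in> x\<close> decides both of their sides, in opposite ways. A vertex without edges is
  vacuously unanimous for both colours and falls into \<open>A\<close>.\<close>

lemma has_oct_if_conflicts:
  assumes "conflicts (card V) x \<le> k"
  shows "has_oct V E k"
proof -
  define S where "S = l ` {v \<in> {1..card V}. conflicted x v}"
  define A where "A = {v \<in> V - S. agree True (inc (pos v)) (pos v) x}"
  have "S \<subseteq> V"
    using l_in by (auto simp: S_def)
  moreover have "card S \<le> k"
    unfolding S_def using assms by (intro order_trans[OF card_image_le]) (auto simp: conflicts_def)
  moreover have "\<exists>a\<in>A. \<exists>b\<in>V - S - A. e = {a, b}" if "e \<in> E" "e \<inter> S = {}" for e
  proof -
    obtain j where j: "j < length es" "e = {l (left_pos j), l (right_pos j)}"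
      using edge_index[OF \<open>e \<in> E\<close>] .
    note edge = edge_by_pos[OF j(1)]
    have S: "l (left_pos j) \<notin> S" "l (right_pos j) \<notin> S"
      using j that by auto
    then have nc: "\<not> conflicted x (left_pos j)" "\<not> conflicted x (right_pos j)"
      using edge by (auto simp: S_def)
    have V: "l (left_pos j) \<in> V" "l (right_pos j) \<in> V"
      using edge l_in by auto
    have "l (left_pos j) \<in> A \<longleftrightarrow> j \<in> x" "l (right_pos j) \<in> A \<longleftrightarrow> j \<notin> x"
      using nc agree_left[OF j(1)] agree_right[OF j(1)] S V pos_l[OF edge(1)] pos_l[OF edge(2)]
      by (auto simp: A_def conflicted_def)
    then show ?thesis
      using j(2) S V by (cases "j \<in> x") (auto simp: insert_commute)
  qed
  then have "bipartite (V - S) {e \<in> E. e \<inter> S = {}}"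
    unfolding bipartite_def by (intro exI[of _ A] exI[of _ "V - S - A"]) (auto simp: A_def)
  ultimately show ?thesis
    unfolding has_oct_def by blast
qed

text \<open>Each edge takes its label from the side of an end outside \<open>S\<close>.
  Bipartiteness makes the other end agree if it survives too, so only vertices of \<open>S\<close>
  can be conflicted.\<close>

lemma conflicts_if_has_oct:
  assumes "has_oct V E k"
  shows "\<exists>x\<subseteq>{..<length es}. conflicts (card V) x \<le> k"
proof -
  from assms obtain S where S: "S \<subseteq> V" "card S \<le> k" "bipartite (V - S) {e \<in> E. e \<inter> S = {}}"
    unfolding has_oct_def by auto
  from S(3) obtain A B where AB: "A \<union> B = V - S" "A \<inter> B = {}"
    and "\<forall>e\<in>{e \<in> E. e \<inter> S = {}}. \<exists>a\<in>A. \<exists>b\<in>B. e = {a, b}"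
    unfolding bipartite_def by auto
  then have bip: "\<exists>a\<in>A. \<exists>b\<in>B. e = {a, b}" if "e \<in> E" "e \<inter> S = {}" for e
    using that by simp
  \<comment> \<open>If the left end is deleted, the right end decides; if both are, the label is
    irrelevant.\<close>
  define x where "x = {j. j < length es \<and>
    (if l (left_pos j) \<in> S then l (right_pos j) \<notin> A else l (left_pos j) \<in> A)}"
  have "agree (v \<in> A) (inc (pos v)) (pos v) x" if v: "v \<in> V - S" for v
    unfolding agree_def
  proof
    fix j assume "j \<in> inc (pos v)"
    then have j: "j < length es" "left_pos j = pos v \<or> right_pos j = pos v"
      by (auto simp: inc_def)
    note edge = edge_by_pos[OF j(1)]
    show "claim (pos v) x j = (v \<in> A)"
    proof (cases "left_pos j = pos v")
      case True
      then show ?thesis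
        using j v l_pos[of v] by (simp add: claim_def x_def)
    next
      case False
      then have right: "l (right_pos j) = v"
        using j v l_pos[of v] by auto
      have "l (left_pos j) \<in> A \<longleftrightarrow> v \<notin> A" if "l (left_pos j) \<notin> S"
      proof -
        have "{l (left_pos j), v} \<in> E"
          using edge(4) edge_ends(4)[OF j(1)] right by simp
        moreover have "{l (left_pos j), v} \<inter> S = {}"
          using that v by simp
        ultimately obtain a b where "a \<in> A" "b \<in> B" "{l (left_pos j), v} = {a, b}"
          using bip by meson
        then show ?thesis
          using AB by (auto simp: doubleton_eq_iff)
      qed
      then show ?thesis
        using False right j by (auto simp: claim_def x_def)
    qed
  qed
  then have "\<not> conflicted x (pos v)" if "v \<in> V - S" for v
    using that by (cases "v \<in> A") (force simp: conflicted_def)+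
  then have "{v \<in> {1..card V}. conflicted x v} \<subseteq> pos ` S"
    using l_in pos_l by (metis (mono_tags, lifting) DiffI image_eqI mem_Collect_eq subsetI)
  moreover have "finite S"
    using S graph finite_subset by (auto simp: simple_graph_def)
  ultimately have "conflicts (card V) x \<le> card S"
    unfolding conflicts_def
    by (meson card_image_le card_mono finite_imageI order_trans)
  moreover have "x \<subseteq> {..<length es}"
    by (auto simp: x_def)
  ultimately show ?thesis
    using S(2) by (meson order_trans)
qed

lemma active_last: "active (card V) = {}"
  using edge_by_pos(2) by (fastforce simp: active_def)

text \<open>The empty trace admits every labelling, so this entry is the global minimum. It is also
  the only entry left at the last cut, which no edge crosses.\<close>

lemma has_oct_iff: "has_oct V E k \<longleftrightarrow> least (conflicts (card V)) {} {} \<le> k"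
proof -
  have "least (conflicts (card V)) {} {} \<le> k \<longleftrightarrow> (\<exists>x\<subseteq>{..<length es}. conflicts (card V) x \<le> k)"
    unfolding least_def using ext_nonempty[of "{}" "{}"] finite_ext[of "{}" "{}"]
    by (subst Min_le_iff) auto
  then show ?thesis
    using has_oct_if_conflicts conflicts_if_has_oct by blast
qed

end

section \<open>The dynamic program\<close>

text \<open>\<open>LIST\<close> enumerates the encodings of the sets of active edges. These are sparse numbers below
  \<open>2 ^ m\<close> that serve as addresses in \<open>TAB\<close> (least number of conflicts), \<open>TABF\<close> and \<open>TABT\<close> (least
  penalty when the current vertex is coloured \<open>False\<close> or \<open>True\<close>); enumerating them explicitly keeps
  the number of visited cells at \<open>2 ^ w\<close> for \<open>w\<close> active edges. \<open>PW\<close> holds the powers of 2.\<close>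

abbreviation (input) "POS \<equiv> 2 :: vname"
abbreviation (input) "LF \<equiv> 3 :: vname"
abbreviation (input) "RT \<equiv> 4 :: vname"
abbreviation (input) "LIST \<equiv> 5 :: vname"
abbreviation (input) "TAB \<equiv> 6 :: vname"
abbreviation (input) "TABF \<equiv> 7 :: vname"
abbreviation (input) "TABT \<equiv> 8 :: vname"
abbreviation (input) "PW \<equiv> 9 :: vname"
abbreviation (input) "I \<equiv> 10 :: vname"
abbreviation (input) "J \<equiv> 11 :: vname"
abbreviation (input) "R \<equiv> 12 :: vname"
abbreviation (input) "Q \<equiv> 13 :: vname"
abbreviation (input) "N \<equiv> 14 :: vname"
abbreviation (input) "M \<equiv> 15 :: vname"

abbreviation (input) "Nvertices \<equiv> Get 0 (Num 0)"
abbreviation (input) "Nedges \<equiv> Get 0 (Num 1)"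
abbreviation (input) "Budget \<equiv> Get 0 (Num 2)"
abbreviation (input) "Bit \<equiv> Get PW (Var J)"

abbreviation Assign :: "vname \<Rightarrow> aexp \<Rightarrow> com" where
  "Assign x e \<equiv> Put x (Num 0) e"

fun block :: "com list \<Rightarrow> com" where
  "block [] = Skip"
| "block (c # cs) = Seq c (block cs)"

text \<open>Truncated subtraction yields the minimum: \<open>Sub a b\<close> is the excess of
  \<open>a\<close> over \<open>b\<close>, which is then removed.\<close>

abbreviation MinE :: "aexp \<Rightarrow> aexp \<Rightarrow> aexp" where
  "MinE a b \<equiv> Sub a (Sub a b)"

lemma diff_diff_min: "(a::nat) - (a - b) = min a b"
  by simp

text \<open>Before any edge of the new vertex has been seen, neither colour is contradicted, so both
  penalty tables start from the conflict table.\<close>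

definition copy :: com where
  "copy = For R (Var N) (block [
    Put TABF (Get LIST (Var R)) (Get TAB (Get LIST (Var R))),
    Put TABT (Get LIST (Var R)) (Get TAB (Get LIST (Var R)))])"

definition merge :: com where
  "merge = For R (Var N) (
    Put TAB (Get LIST (Var R)) (MinE (Get TABF (Get LIST (Var R))) (Get TABT (Get LIST (Var R)))))"

text \<open>The condition tests that edge \<open>j\<close> is absent from the mask. \<open>LIST\<close> is compacted in place, which is
  safe since the write index \<open>Q\<close> never overtakes the read index \<open>R\<close>.\<close>

definition forget_step :: com where
  "forget_step = Seq (Assign M (Get LIST (Var R)))
    (If (Eq (Mul (Num 2) (Div (Div (Var M) Bit) (Num 2))) (Div (Var M) Bit))
      (block [
        Put TABF (Var M) (MinE (Get TABF (Add (Var M) Bit)) (Add (Get TAB (Var M)) (Num 1))),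
        Put TABT (Var M) (MinE (Get TABT (Var M)) (Add (Get TAB (Add (Var M) Bit)) (Num 1))),
        Put TAB (Var M) (MinE (Get TAB (Var M)) (Get TAB (Add (Var M) Bit))),
        Put LIST (Var Q) (Var M),
        Assign Q (Add (Var Q) (Num 1))])
      Skip)"

definition forget :: com where
  "forget = block [Assign Q (Num 0), For R (Var N) forget_step, Assign N (Var Q)]"

text \<open>The order matters: \<open>TABT\<close> at \<open>M\<close> is moved to the new mask
  before it is overwritten. \<open>TABF\<close> at \<open>M\<close> needs no store because a mask
  without \<open>j\<close> claims \<open>False\<close> at the left end, and \<open>TAB\<close> at
  \<open>M\<close> needs none because it ignores \<open>j\<close>. New masks go behind the first
  \<open>N\<close> entries, and \<open>N\<close> changes only after the loop.\<close>

definition intro_step :: com where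
  "intro_step = block [
    Assign M (Get LIST (Var R)),
    Put TABF (Add (Var M) Bit) (Add (Get TAB (Var M)) (Num 1)),
    Put TABT (Add (Var M) Bit) (Get TABT (Var M)),
    Put TABT (Var M) (Add (Get TAB (Var M)) (Num 1)),
    Put TAB (Add (Var M) Bit) (Get TAB (Var M)),
    Put LIST (Add (Var N) (Var R)) (Add (Var M) Bit)]"

definition introduce :: com where
  "introduce = Seq (For R (Var N) intro_step) (Assign N (Mul (Num 2) (Var N)))"

definition vertex_step :: com where
  "vertex_step = block [
    copy,
    For J Nedges (If (Eq (Get RT (Var J)) (Add (Var I) (Num 1))) forget Skip),
    For J Nedges (If (Eq (Get LF (Var J)) (Add (Var I) (Num 1))) introduce Skip),
    merge]"

section \<open>Enumerated masks and the loops that copy and merge tables\<close>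

definition listing :: "state \<Rightarrow> nat set \<Rightarrow> bool" where
  "listing s A \<longleftrightarrow> s N 0 = 2 ^ card A \<and> bij_betw (s LIST) {..<2 ^ card A} (set_encode ` Pow A)"

lemma listing_nth:
  assumes "listing s A" "r < 2 ^ card A"
  obtains y where "y \<subseteq> A" "s LIST r = set_encode y"
proof -
  have "s LIST r \<in> set_encode ` Pow A"
    using assms by (intro bij_betw_apply[of "s LIST" "{..<2 ^ card A}"]) (auto simp: listing_def)
  then show thesis
    using that by auto
qed

lemma listing_image:
  assumes "listing s A" "y \<subseteq> A"
  shows "set_encode y \<in> s LIST ` {..<2 ^ card A}"
  using assms bij_betw_imp_surj_on by (fastforce simp: listing_def)

lemma set_encode_eq_iff:
  "finite A \<Longrightarrow> x \<subseteq> A \<Longrightarrow> y \<subseteq> A \<Longrightarrow> set_encode x = set_encode y \<longleftrightarrow> x = y"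
  by (meson finite_subset set_encode_eq)

lemma set_encode_add:
  "finite A \<Longrightarrow> x \<subseteq> A \<Longrightarrow> j \<notin> x \<Longrightarrow> set_encode x + 2 ^ j = set_encode (insert j x)"
  by (metis add.commute finite_subset set_encode_insert)

text \<open>Bit \<open>j\<close> is the parity of the quotient by \<open>2 ^ j\<close>. Parity is
  tested by halving and doubling, as expressions have no remainder operation.\<close>

lemma even_set_encode_div:
  assumes "finite A" "x \<subseteq> A"
  shows "2 * (set_encode x div 2 ^ j div 2) = set_encode x div 2 ^ j \<longleftrightarrow> j \<notin> x"
proof -
  have "j \<in> x \<longleftrightarrow> odd (set_encode x div 2 ^ j)"
    using assms set_encode_inverse[of x] by (auto simp: set_decode_def finite_subset)
  moreover have "2 * (t div 2) = t \<longleftrightarrow> even t" for t :: nat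
    by presburger
  ultimately show ?thesis by simp
qed

lemma set_encode_less:
  assumes "x \<subseteq> {..<m}"
  shows "set_encode x < 2 ^ m"
proof -
  have "set_encode x \<le> (\<Sum>i<m. 2 ^ i)"
    unfolding set_encode_def using assms by (auto intro: sum_mono2)
  also have "\<dots> < (2::nat) ^ m"
    by (induction m) auto
  finally show ?thesis .
qed

lemma copy_run:
  assumes s: "listing s A" and K: "2 ^ card A < (2::nat) ^ K"
  shows "run K (2 ^ card A + 1) copy s (\<lambda>s'. \<forall>y\<subseteq>A.
    s' TABF (set_encode y) = s TAB (set_encode y) \<and> s' TABT (set_encode y) = s TAB (set_encode y))"
proof (rule run_smallI)
  assume small: "small K s"
  note [simp] = smallD[OF small]
  \<comment> \<open>Phrased by addresses instead of sets, since the loop follows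
    \<open>LIST\<close>; the two views meet at the end through \<open>listing_image\<close>.\<close>
  define Inv where "Inv = (\<lambda>r s'. \<forall>z \<in> s LIST ` {..<r}. s' TABF z = s TAB z \<and> s' TABT z = s TAB (z::nat))"
  have "run K (2 ^ card A + 1) copy s (Inv (2 ^ card A))"
    unfolding copy_def
  proof (rule run_for[where Y = 1])
    fix r s' assume "r < 2 ^ card A" "Inv r s'" "s' R 0 = r"
      and "\<And>x. x \<noteq> R \<Longrightarrow> x \<notin> writes (block [
        Put TABF (Get LIST (Var R)) (Get TAB (Get LIST (Var R))),
        Put TABT (Get LIST (Var R)) (Get TAB (Get LIST (Var R)))]) \<Longrightarrow> s' x = s x"
    then show "run K 1 (block [
        Put TABF (Get LIST (Var R)) (Get TAB (Get LIST (Var R))),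
        Put TABT (Get LIST (Var R)) (Get TAB (Get LIST (Var R)))])
        s' (\<lambda>s''. Inv (Suc r) (put s'' R 0 (Suc r)))"
      unfolding block.simps
      by (intro run_seq run_put run_skip) (auto simp: put_apply Inv_def less_Suc_eq)
  qed (use s K in \<open>auto simp: listing_def Inv_def\<close>)
  then show ?thesis
    unfolding Inv_def by (rule run_mono) (use listing_image[OF s] in \<open>(simp; fail) | blast\<close>)+
qed

lemma merge_run:
  assumes s: "listing s A" and K: "2 ^ card A < (2::nat) ^ K"
  shows "run K (2 ^ card A + 1) merge s (\<lambda>s'. \<forall>y\<subseteq>A.
    s' TAB (set_encode y) = min (s TABF (set_encode y)) (s TABT (set_encode y)))"
proof (rule run_smallI)
  assume small: "small K s"
  note [simp] = smallD[OF small]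
  define Inv where "Inv = (\<lambda>r s'. \<forall>z \<in> s LIST ` {..<r}. s' TAB z = min (s TABF z) (s TABT (z::nat)))"
  have "run K (2 ^ card A + 1) merge s (Inv (2 ^ card A))"
    unfolding merge_def
  proof (rule run_for[where Y = 1])
    fix r s' assume *: "r < 2 ^ card A" "Inv r s'" "s' R 0 = r"
      and "\<And>x. x \<noteq> R \<Longrightarrow> x \<notin> writes (Put TAB (Get LIST (Var R))
        (MinE (Get TABF (Get LIST (Var R))) (Get TABT (Get LIST (Var R))))) \<Longrightarrow> s' x = s x"
    then have "s' LIST = s LIST" "s' TABF = s TABF" "s' TABT = s TABT" by simp_all
    with * show "run K 1 (Put TAB (Get LIST (Var R))
        (MinE (Get TABF (Get LIST (Var R))) (Get TABT (Get LIST (Var R)))))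
        s' (\<lambda>s''. Inv (Suc r) (put s'' R 0 (Suc r)))"
      by (intro run_put)
        (auto simp: put_apply Inv_def less_Suc_eq diff_diff_min min_less_iff_disj)
  qed (use s K in \<open>auto simp: listing_def Inv_def\<close>)
  then show ?thesis
    unfolding Inv_def by (rule run_mono) (use listing_image[OF s] in \<open>(simp; fail) | blast\<close>)+
qed

section \<open>Forgetting and introducing a single edge\<close>

context arranged_edges
begin

definition table :: "state \<Rightarrow> vname \<Rightarrow> (nat set \<Rightarrow> nat) \<Rightarrow> nat set \<Rightarrow> bool" where
  "table s T f A \<longleftrightarrow> (\<forall>y\<subseteq>A. s T (set_encode y) = least f A y)"

definition tables :: "state \<Rightarrow> nat \<Rightarrow> nat set \<Rightarrow> nat set \<Rightarrow> bool" where
  "tables s i P A \<longleftrightarrow> listing s A \<and> table s TAB (conflicts i) A \<and>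
    table s TABF (pen False P i) A \<and> table s TABT (pen True P i) A"

text \<open>Keeps increased entries below \<open>2 ^ K\<close>: at most \<open>i < n\<close>
  vertices can be conflicted so far.\<close>

lemma Suc_least_conflicts_le:
  assumes "A \<subseteq> {..<m}" "y \<subseteq> A" "i < n"
  shows "Suc (least (conflicts i) A y) \<le> n"
  using least_le[where f = "conflicts i" and b = i, OF assms(1,2) conflicts_le] assms(3) by simp

lemma mask_less:
  assumes "y \<subseteq> {..<m}" "m < K"
  shows "set_encode y < 2 ^ K"
proof -
  have "set_encode y < 2 ^ m"
    using assms(1) by (rule set_encode_less)
  also have "\<dots> \<le> 2 ^ K"
    using assms(2) by (intro power_increasing) auto
  finally show ?thesis .
qed

lemma power_card_less:
  assumes "A \<subseteq> {..<m}" "m < K"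
  shows "2 ^ card A < (2::nat) ^ K"
proof -
  have "card A \<le> m"
    using card_mono[OF finite_lessThan assms(1)] by simp
  then show ?thesis
    using assms(2) by (intro power_strict_increasing) auto
qed

text \<open>The pass at \<open>y\<close> reads only the entries of \<open>y\<close> and
  \<open>insert j y\<close>, and only masks without \<open>j\<close> are rewritten, so the tables
  can be updated in place. At \<open>y\<close> itself both penalty tables are updated before
  \<open>TAB\<close>, whose old value they read.\<close>

lemma forget_run:
  assumes s: "tables s i P A" and J: "s J 0 = j" "s PW j = 2 ^ j"
    and j: "j \<in> A" "rt j = Suc i" and A: "A \<subseteq> {..<m}" and K: "m < K" "n < 2 ^ K"
  shows "run K (2 ^ card A + 1) forget s (\<lambda>s'. tables s' i (insert j P) (A - {j}))"
proof -
  have fin: "finite A"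
    using A finite_subset by blast
  have "i < n"
    using j A rt_le[of j] by auto
  have listing: "listing s A" and tab: "\<And>y. y \<subseteq> A \<Longrightarrow> s TAB (set_encode y) = least (conflicts i) A y"
    "\<And>y. y \<subseteq> A \<Longrightarrow> s TABF (set_encode y) = least (pen False P i) A y"
    "\<And>y. y \<subseteq> A \<Longrightarrow> s TABT (set_encode y) = least (pen True P i) A y"
    using s by (auto simp: tables_def table_def)
  have bij: "bij_betw (s LIST) {..<2 ^ card A} (set_encode ` Pow A)" and N: "s N 0 = 2 ^ card A"
    using listing by (auto simp: listing_def)
  have less: "set_encode y < 2 ^ K" if "y \<subseteq> A" for y
    using mask_less[of y K] that A K(1) by simp
  have power_le: "2 ^ card A < (2::nat) ^ K"
    using power_card_less[OF A K(1)] .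
  \<comment> \<open>Measured by the original list, because the current one is being
    compacted.\<close>
  define seen where "seen = (\<lambda>r. {y. y \<subseteq> A - {j} \<and> set_encode y \<in> s LIST ` {..<r}})"
  define Inv where "Inv = (\<lambda>r s'.
    s' Q 0 \<le> r \<and> bij_betw (s' LIST) {..<s' Q 0} (set_encode ` seen r) \<and>
    (\<forall>r'\<ge>r. s' LIST r' = s LIST r') \<and>
    (\<forall>y. y \<subseteq> A \<longrightarrow> y \<notin> seen r \<longrightarrow> s' TAB (set_encode y) = s TAB (set_encode y) \<and>
      s' TABF (set_encode y) = s TABF (set_encode y) \<and> s' TABT (set_encode y) = s TABT (set_encode y)) \<and>
    (\<forall>y\<in>seen r. s' TAB (set_encode y) = least (conflicts i) (A - {j}) y \<and>
      s' TABF (set_encode y) = least (pen False (insert j P) i) (A - {j}) y \<and>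
      s' TABT (set_encode y) = least (pen True (insert j P) i) (A - {j}) y))"
  have step: "run K 1 forget_step s' (\<lambda>s''. Inv (Suc r) (put s'' R 0 (Suc r)))"
    if r: "r < 2 ^ card A" and inv: "Inv r s'" and R: "s' R 0 = r"
      and frame: "s' J = s J" "s' PW = s PW" and small': "small K s'" for r s'
  proof -
    note [simp] = smallD[OF small']
    obtain y where y: "y \<subseteq> A" "s LIST r = set_encode y"
      using listing_nth[OF listing r] .
    have M: "s' LIST r = set_encode y"
      using inv y by (simp add: Inv_def)
    have notin: "set_encode y \<notin> s LIST ` {..<r}"
    proof
      assume "set_encode y \<in> s LIST ` {..<r}"
      then obtain r' where "r' < r" "s LIST r' = s LIST r"
        using y by auto
      then show False
        using bij r by (metis bij_betw_imp_inj_on inj_onD lessThan_iff less_trans less_irrefl)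
    qed
    have new: "seen (Suc r) = (if j \<in> y then seen r else insert y (seen r))"
    proof -
      have "seen (Suc r) = {z. z \<subseteq> A - {j} \<and> (set_encode z = set_encode y \<or> set_encode z \<in> s LIST ` {..<r})}"
        unfolding seen_def lessThan_Suc image_insert y(2) by blast
      also have "\<dots> = {z. z \<subseteq> A - {j} \<and> (z = y \<or> set_encode z \<in> s LIST ` {..<r})}"
        using set_encode_eq_iff[OF fin _ y(1)] by blast
      finally show ?thesis
        using y(1) unfolding seen_def by auto
    qed
    show ?thesis
    proof (cases "j \<in> y")
      case True
      then show ?thesis
        unfolding forget_step_def
        using inv new even_set_encode_div[OF fin y(1), of j] less[OF y(1)]
        by (intro run_seq run_put run_if run_skip) (auto simp: put_array R J frame M Inv_def)
    next
      case False
      have y': "insert j y \<subseteq> A" "y \<subseteq> A - {j}"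
        using y j False by auto
      have add: "set_encode y + 2 ^ j = set_encode (insert j y)"
        by (rule set_encode_add[OF fin y(1) False])
      \<comment> \<open>Both masks read in this pass still have their original entries:
        \<open>y\<close> is listed only once, and \<open>insert j y\<close> contains
        \<open>j\<close>.\<close>
      have unseen: "y \<notin> seen r" "insert j y \<notin> seen r"
        using notin by (auto simp: seen_def)
      let ?y = "set_encode y"
      have old: "s' TAB ?y = least (conflicts i) A y" "s' TABF ?y = least (pen False P i) A y"
        "s' TABT ?y = least (pen True P i) A y"
        "s' TAB (set_encode (insert j y)) = least (conflicts i) A (insert j y)"
        "s' TABF (set_encode (insert j y)) = least (pen False P i) A (insert j y)"
        using inv unseen y(1) y'(1) by (auto simp: Inv_def tab)
      have small_value: "Suc (least (conflicts i) A y) < 2 ^ K" "Suc (least (conflicts i) A (insert j y)) < 2 ^ K"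
        using Suc_least_conflicts_le[OF A y(1) \<open>i < n\<close>] Suc_least_conflicts_le[OF A y'(1) \<open>i < n\<close>] K
        by linarith+
      have even: "2 * (?y div 2 ^ j div 2) = ?y div 2 ^ j"
        using even_set_encode_div[OF fin y(1), of j] False by simp
      have Q_small: "Suc (s' Q 0) < 2 ^ K"
      proof -
        have "s' Q 0 \<le> r"
          using inv by (simp add: Inv_def)
        then show ?thesis
          using r power_le by linarith
      qed
      let ?t = "least (conflicts i) (A - {j}) y"
      let ?f = "least (pen False (insert j P) i) (A - {j}) y"
      let ?g = "least (pen True (insert j P) i) (A - {j}) y"
      have mins: "?t = min (s' TAB ?y) (s' TAB (set_encode (insert j y)))"
        "?f = min (s' TABF (set_encode (insert j y))) (Suc (s' TAB ?y))"
        "?g = min (s' TABT ?y) (Suc (s' TAB (set_encode (insert j y))))"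
        using pen_forget[OF j(1) A y'(2) j(2), of _ P] least_forget[OF j(1) A y'(2)] by (simp_all add: old)
      have update: "s' TAB ?y - (s' TAB ?y - s' TAB (set_encode (insert j y))) = ?t"
        "s' TABF (set_encode (insert j y)) - (s' TABF (set_encode (insert j y)) - Suc (s' TAB ?y)) = ?f"
        "s' TABT ?y - (s' TABT ?y - Suc (s' TAB (set_encode (insert j y)))) = ?g"
        unfolding mins by (rule diff_diff_min)+
      have value_less: "Suc (s' TAB ?y) < 2 ^ K" "?t < 2 ^ K" "?f < 2 ^ K" "?g < 2 ^ K"
        unfolding mins using small_value smallD[OF small', of TAB ?y] smallD[OF small', of TABT ?y]
        by (simp_all only: old min_less_iff_disj simp_thms)
      have "run K 1 forget_step s' (\<lambda>s''. s'' Q = (s' Q)(0 := Suc (s' Q 0)) \<and>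
        s'' LIST = (s' LIST)(s' Q 0 := ?y) \<and>
        s'' TAB = (s' TAB)(?y := least (conflicts i) (A - {j}) y) \<and>
        s'' TABF = (s' TABF)(?y := least (pen False (insert j P) i) (A - {j}) y) \<and>
        s'' TABT = (s' TABT)(?y := least (pen True (insert j P) i) (A - {j}) y))"
        unfolding forget_step_def block.simps
        by (intro run_seq run_put run_if run_skip)
          (simp_all add: put_array R J frame M add update even less[OF y(1)] Q_small value_less
            del: diff_diff_cancel)
      then show ?thesis
      proof (rule run_mono)
        fix s'' assume upd: "s'' Q = (s' Q)(0 := Suc (s' Q 0)) \<and>
          s'' LIST = (s' LIST)(s' Q 0 := ?y) \<and>
          s'' TAB = (s' TAB)(?y := least (conflicts i) (A - {j}) y) \<and>
          s'' TABF = (s' TABF)(?y := least (pen False (insert j P) i) (A - {j}) y) \<and>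
          s'' TABT = (s' TABT)(?y := least (pen True (insert j P) i) (A - {j}) y)"
        have new': "seen (Suc r) = insert y (seen r)"
          using new False by simp
        have "bij_betw (s'' LIST) (insert (s' Q 0) {..<s' Q 0}) (insert ?y (set_encode ` seen r))"
        proof (rule bij_betw_combine[where A = "{_}" and B = "{_}", simplified insert_is_Un[symmetric]])
          show "bij_betw (s'' LIST) {s' Q 0} {?y}"
            using upd by (simp add: bij_betw_def)
          have "bij_betw (s'' LIST) {..<s' Q 0} (set_encode ` seen r) \<longleftrightarrow>
            bij_betw (s' LIST) {..<s' Q 0} (set_encode ` seen r)"
            using upd by (intro bij_betw_cong) simp
          then show "bij_betw (s'' LIST) {..<s' Q 0} (set_encode ` seen r)"
            using inv by (simp add: Inv_def)
          show "{?y} \<inter> set_encode ` seen r = {}"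
            using notin by (auto simp: seen_def)
        qed
        then have bij': "bij_betw (s'' LIST) {..<s'' Q 0} (set_encode ` seen (Suc r))"
          using upd by (simp add: new' lessThan_Suc)
        have other: "set_encode z \<noteq> ?y" if "z \<subseteq> A" "z \<noteq> y" for z
          using set_encode_eq_iff[OF fin that(1) y(1)] that by simp
        have "z \<subseteq> A" "z \<noteq> y" if "z \<in> seen r" for z
          using that unseen by (auto simp: seen_def)
        then have "Inv (Suc r) s''"
          using inv upd bij' other unfolding Inv_def new' by (simp add: Ball_def)
        then show "Inv (Suc r) (put s'' R 0 (Suc r))"
          by (simp add: Inv_def put_array)
      qed simp
    qed
  qed
  show ?thesis
    unfolding forget_def block.simps
  proof (intro run_seq run_put)
    let ?s = "put s Q (aval (Num 0) s) (aval (Num 0) s)"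
    have "run K (2 ^ card A + 1) (For R (Var N) forget_step) ?s (Inv (2 ^ card A))"
    proof (rule run_for[where Y = 1])
      show "2 ^ card A < (2::nat) ^ K" by (fact power_le)
      show "Inv 0 (put ?s R 0 0)"
        by (simp add: Inv_def seen_def put_array bij_betw_def)
      fix r s' assume "r < 2 ^ card A" "Inv r s'" "s' R 0 = r"
        "\<And>x. x \<noteq> R \<Longrightarrow> x \<notin> writes forget_step \<Longrightarrow> s' x = ?s x"
      then show "run K 1 forget_step s' (\<lambda>s''. Inv (Suc r) (put s'' R 0 (Suc r)))"
        by (intro run_smallI[OF step]) (simp_all add: forget_step_def put_array)
    qed (use N in \<open>auto simp: forget_step_def put_array\<close>)
    then show "run K (2 ^ card A + 1) (For R (Var N) forget_step) ?s
      (\<lambda>s'. run K (2 ^ card A + 1) (Seq (Assign N (Var Q)) Skip) s'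
        (\<lambda>s'. tables s' i (insert j P) (A - {j})))"
    proof (rule run_mono)
      fix s' assume inv: "Inv (2 ^ card A) s'"
      have all: "seen (2 ^ card A) = Pow (A - {j})"
        using bij by (auto simp: seen_def bij_betw_def)
      have bij': "bij_betw (s' LIST) {..<s' Q 0} (set_encode ` Pow (A - {j}))"
        using inv by (simp add: Inv_def all)
      \<comment> \<open>The final value of \<open>Q\<close> is obtained by counting: the indices
        below it are in bijection with the subsets of \<open>A - {j}\<close>.\<close>
      have "inj_on set_encode (Pow (A - {j}))"
        using set_encode_eq_iff[of "A - {j}"] fin by (auto simp: inj_on_def)
      then have "s' Q 0 = 2 ^ card (A - {j})"
        using bij_betw_same_card[OF bij'] fin by (simp add: card_image card_Pow)
      then have "tables (put s' N 0 (s' Q 0)) i (insert j P) (A - {j})"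
        using inv bij' by (simp add: tables_def listing_def table_def put_array Inv_def all)
      then show "run K (2 ^ card A + 1) (Seq (Assign N (Var Q)) Skip) s'
        (\<lambda>s'. tables s' i (insert j P) (A - {j}))"
        by (intro run_smallI[OF run_seq] run_put run_skip) (auto dest: smallD)
    qed simp
  qed auto
qed

text \<open>Every new mask contains \<open>j\<close> and no old one does, so the pass at
  \<open>y\<close> leaves the entries of all unvisited masks intact. The list grows behind its
  original end, and the part still to be read does not change.\<close>

lemma introduce_run:
  assumes s: "tables s i P A" and J: "s J 0 = j" "s PW j = 2 ^ j"
    and j: "j < m" "j \<notin> A" "j \<notin> P" "lf j = Suc i" and A: "A \<subseteq> {..<m}" and K: "m < K" "n < 2 ^ K"
  shows "run K (2 ^ card A + 1) introduce s (\<lambda>s'. tables s' i (insert j P) (insert j A))"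
proof -
  have fin: "finite A" and A': "insert j A \<subseteq> {..<m}"
    using A j finite_subset by auto
  have "i < n"
    using j lf_less_rt[of j] rt_le[of j] by auto
  have listing: "listing s A" and tab: "\<And>y. y \<subseteq> A \<Longrightarrow> s TAB (set_encode y) = least (conflicts i) A y"
    "\<And>y. y \<subseteq> A \<Longrightarrow> s TABF (set_encode y) = least (pen False P i) A y"
    "\<And>y. y \<subseteq> A \<Longrightarrow> s TABT (set_encode y) = least (pen True P i) A y"
    using s by (auto simp: tables_def table_def)
  have bij: "bij_betw (s LIST) {..<2 ^ card A} (set_encode ` Pow A)" and N: "s N 0 = 2 ^ card A"
    using listing by (auto simp: listing_def)
  have less: "set_encode y < 2 ^ K" if "y \<subseteq> insert j A" for y
    using mask_less[of y K] that A' K(1) by blast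
  have power_le: "2 ^ card A < (2::nat) ^ K"
    using power_card_less[OF A K(1)] .
  \<comment> \<open>The doubled \<open>N\<close> must fit into a cell as well; this holds because
    \<open>insert j A\<close> still has at most \<open>m < K\<close> elements.\<close>
  have double_le: "2 * 2 ^ card A < (2::nat) ^ K"
    using power_card_less[OF A' K(1)] fin j by simp
  define seen where "seen = (\<lambda>r. {y. y \<subseteq> A \<and> set_encode y \<in> s LIST ` {..<r}})"
  define Inv where "Inv = (\<lambda>r s'.
    (\<forall>r'<2 ^ card A. s' LIST r' = s LIST r') \<and>
    (\<forall>r'<r. s' LIST (2 ^ card A + r') = s LIST r' + 2 ^ j) \<and>
    (\<forall>y. y \<subseteq> A \<longrightarrow> y \<notin> seen r \<longrightarrow> s' TAB (set_encode y) = s TAB (set_encode y) \<and>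
      s' TABF (set_encode y) = s TABF (set_encode y) \<and> s' TABT (set_encode y) = s TABT (set_encode y)) \<and>
    (\<forall>y\<in>seen r. \<forall>z\<in>{y, insert j y}. s' TAB (set_encode z) = least (conflicts i) (insert j A) z \<and>
      s' TABF (set_encode z) = least (pen False (insert j P) i) (insert j A) z \<and>
      s' TABT (set_encode z) = least (pen True (insert j P) i) (insert j A) z))"
  have step: "run K 1 intro_step s' (\<lambda>s''. Inv (Suc r) (put s'' R 0 (Suc r)))"
    if r: "r < 2 ^ card A" and inv: "Inv r s'" and R: "s' R 0 = r"
      and frame: "s' J = s J" "s' PW = s PW" "s' N = s N" and small': "small K s'" for r s'
  proof -
    note [simp] = smallD[OF small']
    obtain y where y: "y \<subseteq> A" "s LIST r = set_encode y"
      using listing_nth[OF listing r] .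
    have M: "s' LIST r = set_encode y"
      using inv y r by (simp add: Inv_def)
    have "set_encode y \<notin> s LIST ` {..<r}"
    proof
      assume "set_encode y \<in> s LIST ` {..<r}"
      then obtain r' where "r' < r" "s LIST r' = s LIST r"
        using y by auto
      then show False
        using bij r by (metis bij_betw_imp_inj_on inj_onD lessThan_iff less_trans less_irrefl)
    qed
    then have unseen: "y \<notin> seen r"
      by (simp add: seen_def)
    have new: "seen (Suc r) = insert y (seen r)"
    proof -
      have "seen (Suc r) = {z. z \<subseteq> A \<and> (set_encode z = set_encode y \<or> set_encode z \<in> s LIST ` {..<r})}"
        unfolding seen_def lessThan_Suc image_insert y(2) by blast
      also have "\<dots> = {z. z \<subseteq> A \<and> (z = y \<or> set_encode z \<in> s LIST ` {..<r})}"
        using set_encode_eq_iff[OF fin _ y(1)] by blast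
      finally show ?thesis
        using y(1) unfolding seen_def by auto
    qed
    have jy: "j \<notin> y" and y': "y \<subseteq> insert j A" "insert j y \<subseteq> insert j A"
      using y j by auto
    let ?y = "set_encode y"
    let ?y' = "set_encode (insert j y)"
    have add: "?y + 2 ^ j = ?y'"
      by (rule set_encode_add[OF fin y(1) jy])
    have distinct: "?y \<noteq> ?y'"
      using add by (metis add_cancel_right_right power_not_zero zero_neq_numeral)
    have old: "s' TAB ?y = least (conflicts i) A y" "s' TABF ?y = least (pen False P i) A y"
      "s' TABT ?y = least (pen True P i) A y"
      using inv unseen y(1) by (auto simp: Inv_def tab)
    have small_value: "Suc (least (conflicts i) A y) < 2 ^ K"
      using Suc_least_conflicts_le[OF A y(1) \<open>i < n\<close>] K by linarith
    have small_pen: "least (pen True P i) A y < 2 ^ K"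
      unfolding old(3)[symmetric] by simp
    have "run K 1 intro_step s' (\<lambda>s''.
      s'' LIST = (s' LIST)(2 ^ card A + r := ?y') \<and>
      s'' TAB = (s' TAB)(?y' := least (conflicts i) A y) \<and>
      s'' TABF = (s' TABF)(?y' := Suc (least (conflicts i) A y)) \<and>
      s'' TABT = (s' TABT)(?y' := least (pen True P i) A y, ?y := Suc (least (conflicts i) A y)))"
      using distinct
      unfolding intro_step_def block.simps
      by (intro run_seq run_put run_skip)
        (simp_all add: put_array R J frame M N add old less[OF y'(1)] less[OF y'(2)] small_value Suc_lessD[OF small_value] small_pen)
    then show ?thesis
    proof (rule run_mono)
      fix s'' assume upd: "s'' LIST = (s' LIST)(2 ^ card A + r := ?y') \<and>
        s'' TAB = (s' TAB)(?y' := least (conflicts i) A y) \<and>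
        s'' TABF = (s' TABF)(?y' := Suc (least (conflicts i) A y)) \<and>
        s'' TABT = (s' TABT)(?y' := least (pen True P i) A y, ?y := Suc (least (conflicts i) A y))"
      have at_new: "s'' TAB (set_encode z) = least (conflicts i) (insert j A) z \<and>
        s'' TABF (set_encode z) = least (pen False (insert j P) i) (insert j A) z \<and>
        s'' TABT (set_encode z) = least (pen True (insert j P) i) (insert j A) z"
        if "z = y \<or> z = insert j y" for z
        using that upd distinct old conflicts_introduce[OF j(2,1) y(1) j(4)]
          pen_introduce[OF j(2) A j(1) y(1) j(4,3), of True] pen_introduce[OF j(2) A j(1) y(1) j(4,3), of False]
        by auto
      have other: "set_encode z \<noteq> ?y \<and> set_encode z \<noteq> ?y'" if "z \<subseteq> insert j A" "z \<noteq> y" "z \<noteq> insert j y" for z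
        using set_encode_eq_iff[of "insert j A" z] fin y' that by simp
      have rest: "s'' TAB (set_encode z) = s' TAB (set_encode z) \<and>
        s'' TABF (set_encode z) = s' TABF (set_encode z) \<and> s'' TABT (set_encode z) = s' TABT (set_encode z)"
        if "z \<subseteq> insert j A" "z \<noteq> y" "z \<noteq> insert j y" for z
        using upd other[OF that] by simp
      have "Inv (Suc r) s''"
        unfolding Inv_def new
      proof (intro conjI allI impI ballI)
        fix r' :: nat assume "r' < 2 ^ card A"
        then show "s'' LIST r' = s LIST r'"
          using inv upd by (simp add: Inv_def)
      next
        fix r' assume "r' < Suc r"
        then show "s'' LIST (2 ^ card A + r') = s LIST r' + 2 ^ j"
          using inv upd y add by (auto simp: Inv_def less_Suc_eq)
      next
        fix z assume z: "z \<subseteq> A" "z \<notin> insert y (seen r)"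
        then have "z \<noteq> insert j y" "z \<subseteq> insert j A"
          using j by auto
        then show "s'' TAB (set_encode z) = s TAB (set_encode z)"
          "s'' TABF (set_encode z) = s TABF (set_encode z)" "s'' TABT (set_encode z) = s TABT (set_encode z)"
          using inv rest[of z] z by (simp_all add: Inv_def)
      next
        fix u z assume u: "u \<in> insert y (seen r)" and z: "z \<in> {u, insert j u}"
        have "s'' TAB (set_encode z) = least (conflicts i) (insert j A) z \<and>
          s'' TABF (set_encode z) = least (pen False (insert j P) i) (insert j A) z \<and>
          s'' TABT (set_encode z) = least (pen True (insert j P) i) (insert j A) z"
        proof (cases "u = y")
          case True
          then show ?thesis using z at_new by simp
        next
          case False
          then have useen: "u \<in> seen r" "u \<subseteq> A"
            using u by (auto simp: seen_def)
          then have "z \<subseteq> insert j A" "z \<noteq> y" "z \<noteq> insert j y"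
            using z False y(1) j(2) unseen by auto
          note rest[OF this]
          moreover have "s' TAB (set_encode z) = least (conflicts i) (insert j A) z \<and>
            s' TABF (set_encode z) = least (pen False (insert j P) i) (insert j A) z \<and>
            s' TABT (set_encode z) = least (pen True (insert j P) i) (insert j A) z"
            using inv useen(1) z unfolding Inv_def by blast
          ultimately show ?thesis by simp
        qed
        then show "s'' TAB (set_encode z) = least (conflicts i) (insert j A) z"
          "s'' TABF (set_encode z) = least (pen False (insert j P) i) (insert j A) z"
          "s'' TABT (set_encode z) = least (pen True (insert j P) i) (insert j A) z"
          by simp_all
      qed
      then show "Inv (Suc r) (put s'' R 0 (Suc r))"
        by (simp add: Inv_def put_array)
    qed simp
  qed
  have "run K (2 ^ card A + 1) (For R (Var N) intro_step) s (Inv (2 ^ card A))"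
  proof (rule run_for[where Y = 1])
    show "2 ^ card A < (2::nat) ^ K" by (fact power_le)
    show "Inv 0 (put s R 0 0)"
      by (simp add: Inv_def seen_def put_array)
    fix r s' assume "r < 2 ^ card A" "Inv r s'" "s' R 0 = r"
      "\<And>x. x \<noteq> R \<Longrightarrow> x \<notin> writes intro_step \<Longrightarrow> s' x = s x"
    then show "run K 1 intro_step s' (\<lambda>s''. Inv (Suc r) (put s'' R 0 (Suc r)))"
      by (intro run_smallI[OF step]) (simp_all add: intro_step_def put_array)
  qed (use N in \<open>auto simp: intro_step_def put_array\<close>)
  then show ?thesis
    unfolding introduce_def
  proof (rule run_seq_frame)
    fix s' assume inv: "Inv (2 ^ card A) s'" and "\<And>x. x \<notin> writes (For R (Var N) intro_step) \<Longrightarrow> s' x = s x"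
    then have N': "s' N 0 = 2 ^ card A"
      using N by (simp add: intro_step_def)
    have seen: "seen (2 ^ card A) = Pow A"
      using bij by (auto simp: seen_def bij_betw_def)
    let ?c = "2 ^ card A :: nat"
    have "{..<2 * ?c} = {..<?c} \<union> (+) ?c ` {..<?c}"
      by (auto simp: lessThan_atLeast0 image_add_atLeastLessThan simp del: image_add_atLeastLessThan')
    then have "s' LIST ` {..<2 * ?c} = s LIST ` {..<?c} \<union> (\<lambda>r. s LIST r + 2 ^ j) ` {..<?c}"
      using inv by (simp add: image_Un image_image Inv_def)
    also have "(\<lambda>r. s LIST r + 2 ^ j) ` {..<?c} = (\<lambda>z. z + 2 ^ j) ` s LIST ` {..<?c}"
      by (simp add: image_image)
    also have "s LIST ` {..<?c} = set_encode ` Pow A"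
      using bij by (simp add: bij_betw_def)
    also have "(\<lambda>z. z + 2 ^ j) ` set_encode ` Pow A = set_encode ` insert j ` Pow A"
      unfolding image_image using set_encode_add[OF fin] j(2) by (intro image_cong) auto
    finally have image: "s' LIST ` {..<2 * ?c} = set_encode ` Pow (insert j A)"
      by (simp add: Pow_insert image_Un)
    have "inj_on set_encode (Pow (insert j A))"
      using set_encode_eq_iff[of "insert j A"] fin by (auto simp: inj_on_def)
    \<comment> \<open>Injectivity by counting: the image is as large as the index range.\<close>
    then have "card (s' LIST ` {..<2 * ?c}) = 2 * ?c"
      using fin j(2) by (simp add: image card_image card_Pow)
    then have "inj_on (s' LIST) {..<2 * ?c}"
      by (intro eq_card_imp_inj_on) simp_all
    with image have "listing (put s' N 0 (2 * ?c)) (insert j A)"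
      using fin j(2) by (simp add: listing_def put_array bij_betw_def)
    moreover have "table (put s' N 0 (2 * ?c)) TAB (conflicts i) (insert j A)"
      "table (put s' N 0 (2 * ?c)) TABF (pen False (insert j P) i) (insert j A)"
      "table (put s' N 0 (2 * ?c)) TABT (pen True (insert j P) i) (insert j A)"
    proof -
      have "\<exists>y\<in>Pow A. z \<in> {y, insert j y}" if "z \<subseteq> insert j A" for z
      proof (cases "j \<in> z")
        case True
        then have "z - {j} \<in> Pow A" "z = insert j (z - {j})"
          using that by auto
        then show ?thesis by blast
      qed (use that in auto)
      moreover have "\<forall>y\<in>Pow A. \<forall>z\<in>{y, insert j y}. s' TAB (set_encode z) = least (conflicts i) (insert j A) z \<and>
        s' TABF (set_encode z) = least (pen False (insert j P) i) (insert j A) z \<and>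
        s' TABT (set_encode z) = least (pen True (insert j P) i) (insert j A) z"
        using inv unfolding Inv_def seen by (elim conjE)
      ultimately have "s' TAB (set_encode z) = least (conflicts i) (insert j A) z \<and>
        s' TABF (set_encode z) = least (pen False (insert j P) i) (insert j A) z \<and>
        s' TABT (set_encode z) = least (pen True (insert j P) i) (insert j A) z"
        if "z \<subseteq> insert j A" for z
        using that by meson
      then show "table (put s' N 0 (2 * ?c)) TAB (conflicts i) (insert j A)"
        "table (put s' N 0 (2 * ?c)) TABF (pen False (insert j P) i) (insert j A)"
        "table (put s' N 0 (2 * ?c)) TABT (pen True (insert j P) i) (insert j A)"
        unfolding table_def by (simp_all add: put_array)
    qed
    ultimately show "run K (2 ^ card A + 1) (Assign N (Mul (Num 2) (Var N))) s'
        (\<lambda>s'. tables s' i (insert j P) (insert j A))"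
      using N' double_le by (intro run_put) (auto simp: tables_def)
  qed simp
qed

end

section \<open>Passing from one cut to the next\<close>

context arranged_edges
begin

definition ready :: "state \<Rightarrow> bool" where
  "ready s \<longleftrightarrow> s 0 0 = n \<and> s 0 1 = m \<and>
    (\<forall>j<m. s LF j = lf j \<and> s RT j = rt j \<and> s PW j = 2 ^ j)"

definition layer :: "state \<Rightarrow> nat \<Rightarrow> bool" where
  "layer s i \<longleftrightarrow> listing s (active i) \<and> table s TAB (conflicts i) (active i)"

lemma tables_put_J: "tables (put s J a v) i P A = tables s i P A"
  by (simp add: tables_def table_def listing_def put_array)

lemma active_subset: "active i \<subseteq> {..<m}"
  by (auto simp: active_def)

lemma writes_steps:
  "writes copy = {TABF, TABT, R}" "writes merge = {TAB, R}"
  "writes forget = {TAB, TABF, TABT, LIST, N, Q, R, M}"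
  "writes introduce = {TAB, TABF, TABT, LIST, N, R, M}"
  by (auto simp: copy_def merge_def forget_def forget_step_def introduce_def intro_step_def)

text \<open>A single factor \<open>Suc m\<close> covers both edge loops, since the bound concerns
  repetitions of one step and the loops run one after the other.\<close>

lemma vertex_run:
  assumes ready: "ready s" and layer: "layer s i" and i: "s I 0 = i" "i < n"
    and K: "m < K" "n < 2 ^ K" and w: "\<And>i. card (active i) \<le> w"
  shows "run K (Suc m * (2 ^ w + 1)) vertex_step s (\<lambda>s'. layer s' (Suc i))"
proof -
  let ?Y = "2 ^ w + 1 :: nat"
  let ?X = "Suc m * ?Y"
  have m: "m < 2 ^ K"
    using K(1) less_exp[of K] by linarith
  \<comment> \<open>Forgetting passes through subsets of \<open>active i\<close> and introducing
    through subsets of \<open>active (Suc i)\<close>, so no intermediate list is longer than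
    \<open>2 ^ w\<close>.\<close>
  have le: "2 ^ card A + 1 \<le> ?Y" if "A \<subseteq> active i \<or> A \<subseteq> active (Suc i)" for A
  proof -
    have "card A \<le> w"
      using that w[of i] w[of "Suc i"] card_mono[of "active i" A] card_mono[of "active (Suc i)" A]
        finite_subset[OF active_subset] by fastforce
    then show ?thesis by simp
  qed
  have Y_le: "?Y \<le> ?X"
    unfolding mult_Suc by (rule le_add1)
  define F where "F = (\<lambda>j. {j'. j' < j \<and> rt j' = Suc i})"
  define L where "L = (\<lambda>j. {j'. j' < j \<and> lf j' = Suc i})"
  have F_Suc: "F (Suc j) = (if rt j = Suc i then insert j (F j) else F j)" for j
    by (auto simp: F_def less_Suc_eq)
  have L_Suc: "L (Suc j) = (if lf j = Suc i then insert j (L j) else L j)" for j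
    by (auto simp: L_def less_Suc_eq)
  have F_m: "active i - F m = active i \<inter> active (Suc i)"
    by (auto simp: F_def active_def)
  \<comment> \<open>An edge that starts at the new vertex ends strictly later and thus crosses the
    next cut.\<close>
  have "Suc i < rt j" if "j < m" "lf j = Suc i" for j
    using lf_less_rt[OF that(1)] that(2) by simp
  then have L_m: "(active i - F m) \<union> L m = active (Suc i)" "F m \<union> L m = inc (Suc i)"
    by (auto simp: F_def L_def active_def inc_def le_Suc_eq)
  have frame_ready: "s' 0 0 = n" "s' 0 1 = m" "s' I 0 = i"
    "j < m \<Longrightarrow> s' LF j = lf j" "j < m \<Longrightarrow> s' RT j = rt j" "j < m \<Longrightarrow> s' PW j = 2 ^ j"
    if "\<And>x. x \<in> {0, LF, RT, PW, I} \<Longrightarrow> s' x = s x" for s' j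
    using ready i that by (auto simp: ready_def)
  let ?forget = "If (Eq (Get RT (Var J)) (Add (Var I) (Num 1))) forget Skip"
  let ?introduce = "If (Eq (Get LF (Var J)) (Add (Var I) (Num 1))) introduce Skip"
  have r1: "run K ?X copy s (\<lambda>s'. tables s' i {} (active i) \<and> (\<forall>x\<in>{0, LF, RT, PW, I}. s' x = s x))"
  proof (rule run_mono[OF copy_run])
    show "listing s (active i)"
      using layer by (simp add: layer_def)
    show "2 ^ card (active i) < (2::nat) ^ K"
      using power_card_less[OF active_subset K(1)] .
    show "2 ^ card (active i) + 1 \<le> ?X"
      by (rule order_trans[OF le Y_le]) simp
  qed (use layer in \<open>auto simp: layer_def tables_def table_def listing_def pen_empty writes_steps\<close>)
  have r2: "run K ?X (For J Nedges ?forget) s1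
      (\<lambda>s'. tables s' i (F m) (active i - F m) \<and> (\<forall>x\<in>{0, LF, RT, PW, I}. s' x = s x))"
    if "tables s1 i {} (active i)" and s1: "\<forall>x\<in>{0, LF, RT, PW, I}. s1 x = s x" for s1
  proof -
    have "run K ?X (For J Nedges ?forget) s1 (\<lambda>s'. tables s' i (F m) (active i - F m))"
    proof (rule run_for[where Y = ?Y and I = "\<lambda>j s'. tables s' i (F j) (active i - F j)"])
      show "tables (put s1 J 0 0) i (F 0) (active i - F 0)"
        using that by (auto simp: F_def tables_put_J)
      fix j s' assume j: "j < m" "tables s' i (F j) (active i - F j)" "s' J 0 = j"
        and frame: "\<And>x. x \<noteq> J \<Longrightarrow> x \<notin> writes ?forget \<Longrightarrow> s' x = s1 x"
      have "s' x = s x" if "x \<in> {0, LF, RT, PW, I}" for x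
        using frame[of x] s1 that by (auto simp: writes_steps)
      note r = frame_ready[OF this]
      show "run K ?Y ?forget s'
        (\<lambda>s''. tables (put s'' J 0 (Suc j)) i (F (Suc j)) (active i - F (Suc j)))"
      proof (rule run_if)
        assume "bval (Eq (Get RT (Var J)) (Add (Var I) (Num 1))) s'"
        then have rt: "rt j = Suc i"
          using j r by simp
        show "run K ?Y forget s'
          (\<lambda>s''. tables (put s'' J 0 (Suc j)) i (F (Suc j)) (active i - F (Suc j)))"
        proof (rule run_mono[OF forget_run[OF j(2,3)]])
          show "s' PW j = 2 ^ j" "rt j = Suc i" "m < K" "n < 2 ^ K"
            using r j rt K by auto
          show "j \<in> active i - F j"
            using rt j lf_less_rt[of j] by (auto simp: active_def F_def)
          show "active i - F j \<subseteq> {..<m}"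
            using active_subset by auto
          show "2 ^ card (active i - F j) + 1 \<le> ?Y"
            by (rule le) auto
          fix s'' assume "tables s'' i (insert j (F j)) (active i - F j - {j})"
          moreover have "active i - F j - {j} = active i - F (Suc j)"
            using rt by (auto simp: F_Suc)
          ultimately show "tables (put s'' J 0 (Suc j)) i (F (Suc j)) (active i - F (Suc j))"
            using rt by (simp add: F_Suc tables_put_J)
        qed
      next
        assume "\<not> bval (Eq (Get RT (Var J)) (Add (Var I) (Num 1))) s'"
        then have "rt j \<noteq> Suc i"
          using j r by simp
        then show "run K ?Y Skip s'
          (\<lambda>s''. tables (put s'' J 0 (Suc j)) i (F (Suc j)) (active i - F (Suc j)))"
          using j(2) by (intro run_skip) (auto simp: F_Suc tables_put_J)
      qed simp
    next
      fix s' assume "\<And>x. x \<noteq> J \<Longrightarrow> x \<notin> writes ?forget \<Longrightarrow> s' x = s1 x"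
      then have "s' 0 = s 0"
        using s1 by (simp add: writes_steps)
      then show "aval Nedges s' = m"
        using ready by (simp add: ready_def)
    qed (use m in \<open>auto simp: writes_steps\<close>)
    then show ?thesis
      by (rule run_mono) (use s1 in \<open>auto simp: writes_steps\<close>)
  qed
  have r3: "run K ?X (For J Nedges ?introduce) s1
      (\<lambda>s'. tables s' i (inc (Suc i)) (active (Suc i)))"
    if "tables s1 i (F m) (active i - F m)" and s1: "\<forall>x\<in>{0, LF, RT, PW, I}. s1 x = s x" for s1
  proof -
    have "run K ?X (For J Nedges ?introduce) s1
      (\<lambda>s'. tables s' i (F m \<union> L m) (active i - F m \<union> L m))"
    proof (rule run_for[where Y = ?Y and I = "\<lambda>j s'. tables s' i (F m \<union> L j) (active i - F m \<union> L j)"])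
      show "tables (put s1 J 0 0) i (F m \<union> L 0) (active i - F m \<union> L 0)"
        using that by (auto simp: L_def tables_put_J)
      fix j s' assume j: "j < m" "tables s' i (F m \<union> L j) (active i - F m \<union> L j)" "s' J 0 = j"
        and frame: "\<And>x. x \<noteq> J \<Longrightarrow> x \<notin> writes ?introduce \<Longrightarrow> s' x = s1 x"
      have "s' x = s x" if "x \<in> {0, LF, RT, PW, I}" for x
        using frame[of x] s1 that by (auto simp: writes_steps)
      note r = frame_ready[OF this]
      have sub: "active i - F m \<union> L j \<subseteq> active (Suc i)"
        using j(1) by (subst L_m(1)[symmetric]) (auto simp: L_def)
      show "run K ?Y ?introduce s'
        (\<lambda>s''. tables (put s'' J 0 (Suc j)) i (F m \<union> L (Suc j)) (active i - F m \<union> L (Suc j)))"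
      proof (rule run_if)
        assume "bval (Eq (Get LF (Var J)) (Add (Var I) (Num 1))) s'"
        then have lf: "lf j = Suc i"
          using j r by simp
        show "run K ?Y introduce s'
          (\<lambda>s''. tables (put s'' J 0 (Suc j)) i (F m \<union> L (Suc j)) (active i - F m \<union> L (Suc j)))"
        proof (rule run_mono[OF introduce_run[OF j(2,3)]])
          show "s' PW j = 2 ^ j" "lf j = Suc i" "j < m" "m < K" "n < 2 ^ K"
            using r j lf K by auto
          show "j \<notin> active i - F m \<union> L j" "j \<notin> F m \<union> L j"
            using lf j lf_less_rt[of j] by (auto simp: active_def F_def L_def)
          show "active i - F m \<union> L j \<subseteq> {..<m}"
            using sub active_subset by blast
          show "2 ^ card (active i - F m \<union> L j) + 1 \<le> ?Y"
            using sub by (intro le) auto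
          fix s'' assume "tables s'' i (insert j (F m \<union> L j)) (insert j (active i - F m \<union> L j))"
          then show "tables (put s'' J 0 (Suc j)) i (F m \<union> L (Suc j)) (active i - F m \<union> L (Suc j))"
            using lf by (simp add: L_Suc tables_put_J)
        qed
      next
        assume "\<not> bval (Eq (Get LF (Var J)) (Add (Var I) (Num 1))) s'"
        then have "lf j \<noteq> Suc i"
          using j r by simp
        then show "run K ?Y Skip s'
          (\<lambda>s''. tables (put s'' J 0 (Suc j)) i (F m \<union> L (Suc j)) (active i - F m \<union> L (Suc j)))"
          using j(2) by (intro run_skip) (auto simp: L_Suc tables_put_J)
      qed simp
    next
      fix s' assume "\<And>x. x \<noteq> J \<Longrightarrow> x \<notin> writes ?introduce \<Longrightarrow> s' x = s1 x"
      then have "s' 0 = s 0"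
        using s1 by (simp add: writes_steps)
      then show "aval Nedges s' = m"
        using ready by (simp add: ready_def)
    qed (use m in \<open>auto simp: writes_steps\<close>)
    then show ?thesis
      by (simp only: L_m)
  qed
  have r4: "run K ?X merge s1 (\<lambda>s'. layer s' (Suc i))"
    if tables: "tables s1 i (inc (Suc i)) (active (Suc i))" for s1
  proof (rule run_mono[OF merge_run])
    show "listing s1 (active (Suc i))"
      using tables by (simp add: tables_def)
    show "2 ^ card (active (Suc i)) < (2::nat) ^ K"
      using power_card_less[OF active_subset K(1)] .
    show "2 ^ card (active (Suc i)) + 1 \<le> ?X"
      by (rule order_trans[OF le Y_le]) simp
  qed (use tables in \<open>auto simp: layer_def tables_def table_def listing_def writes_steps
      least_conflicts_Suc[OF active_subset]\<close>)
  have X: "0 < ?X" by simp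
  show ?thesis
    unfolding vertex_step_def block.simps
    by (rule run_seq_frame, rule r1, rule order_refl, rule run_seq_frame, erule conjE,
      erule r2, assumption, rule order_refl, rule run_seq_frame, erule conjE,
      erule r3, assumption, rule order_refl, rule run_seq_frame, erule r4, rule order_refl, rule run_skip, rule X)
qed

end

section \<open>Reading the input, and the whole program\<close>

definition positions :: com where
  "positions = For I Nvertices (Put POS (Get 0 (Add (Num 3) (Var I))) (Add (Var I) (Num 1)))"

text \<open>The offsets skip the three header numbers and the vertices. With truncated subtraction,
  \<open>M + (Q - M)\<close> is the maximum. Powers of 2 are filled in one index ahead, so the last
  pass stores 2 to the number of edges, and this too must stay below \<open>2 ^ K\<close>.\<close>

definition edge_step :: com where
  "edge_step = block [
    Assign M (Get POS (Get 0 (Add (Add (Num 3) Nvertices) (Mul (Num 2) (Var J))))),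
    Assign Q (Get POS (Get 0 (Add (Add (Num 4) Nvertices) (Mul (Num 2) (Var J))))),
    Put LF (Var J) (MinE (Var M) (Var Q)),
    Put RT (Var J) (Add (Var M) (Sub (Var Q) (Var M))),
    Put PW (Add (Var J) (Num 1)) (Mul (Num 2) (Get PW (Var J)))]"

definition edges :: com where
  "edges = Seq (Put PW (Num 0) (Num 1)) (For J Nedges edge_step)"

text \<open>Memory starts out as zero, so \<open>LIST\<close> and \<open>TAB\<close> already
  describe the cut at index 0 once \<open>N\<close> is 1: the empty set has mask 0 and conflict
  count 0. The output cell is zero as well, which is the answer in the \<open>Skip\<close>
  branch.\<close>

definition oct_program :: com where
  "oct_program = block [
    positions,
    edges,
    Assign N (Num 1),
    For I Nvertices vertex_step,
    If (Less Budget (Get TAB (Num 0))) Skip (Assign 1 (Num 1))]"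

lemma nth_concat_pairs:
  "j < length es \<Longrightarrow> concat (map (\<lambda>(u, v). [u, v]) es) ! (2 * j) = fst (es ! j) \<and>
    concat (map (\<lambda>(u, v). [u, v]) es) ! Suc (2 * j) = snd (es ! j)"
proof (induction es arbitrary: j)
  case (Cons e es)
  then show ?case
    by (cases j) (auto simp: case_prod_unfold)
qed simp

lemma length_concat_pairs: "length (concat (map (\<lambda>(u, v). [u, v]) es)) = 2 * length es"
  by (induction es) auto

lemma less_power_input_size:
  assumes "x \<in> set xs"
  shows "x < 2 ^ input_size xs"
proof -
  have "x < 2 ^ len x"
  proof (cases "x = 0")
    case False
    then have "x < 2 ^ floorlog 2 x"
      using floorlog_bounds[of x 2] by simp
    also have "\<dots> \<le> 2 ^ len x"
      by (intro power_increasing) (auto simp: len_def)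
    finally show ?thesis .
  qed simp
  also have "len x \<le> input_size xs"
    unfolding input_size_def using assms by (intro member_le_sum_list) auto
  then have "(2::nat) ^ len x \<le> 2 ^ input_size xs"
    by (intro power_increasing) auto
  finally show ?thesis .
qed

lemma length_le_input_size: "length xs \<le> input_size xs"
  by (induction xs) (auto simp: input_size_def len_def)

context arranged_graph
begin

text \<open>Vertex names serve directly as addresses, which under logarithmic cost is charged by
  their length only. Injectivity of the arrangement protects earlier entries from being
  overwritten.\<close>

lemma positions_run:
  assumes s: "s 0 0 = card V" "\<And>i. i < card V \<Longrightarrow> s 0 (3 + i) = l (Suc i)"
    and K: "card V < 2 ^ K"
  shows "run K (Suc (card V)) positions s (\<lambda>s'. \<forall>v\<in>V. s' POS v = pos v)"
proof -
  define Inv where "Inv = (\<lambda>k s'. \<forall>i<k. s' POS (l (Suc i)) = Suc i)"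
  have inj: "l (Suc i) = l (Suc i') \<longleftrightarrow> i = i'" if "i < card V" "i' < card V" for i i'
    using inj_on_eq_iff[OF bij_betw_imp_inj_on[OF bij], of "Suc i" "Suc i'"] that by simp
  have "run K (Suc (card V)) positions s (Inv (card V))"
    unfolding positions_def
  proof (rule run_for[where Y = 1])
    fix k s' assume k: "k < card V" "Inv k s'" "s' I 0 = k"
      and frame: "\<And>x. x \<noteq> I \<Longrightarrow> x \<notin> writes (Put POS (Get 0 (Add (Num 3) (Var I))) (Add (Var I) (Num 1))) \<Longrightarrow> s' x = s x"
    then have "s' 0 = s 0"
      by simp
    then have "aval (Get 0 (Add (Num 3) (Var I))) s' = l (Suc k)"
      using s k by simp
    then show "run K 1 (Put POS (Get 0 (Add (Num 3) (Var I))) (Add (Var I) (Num 1))) s'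
        (\<lambda>s''. Inv (Suc k) (put s'' I 0 (Suc k)))"
      using k K inj by (intro run_put) (auto simp: Inv_def put_array less_Suc_eq)
  qed (use s K in \<open>auto simp: Inv_def\<close>)
  then show ?thesis
  proof (rule run_mono)
    fix s' assume inv: "Inv (card V) s'"
    show "\<forall>v\<in>V. s' POS v = pos v"
    proof
      fix v assume v: "v \<in> V"
      then obtain i where "pos v = Suc i" "i < card V"
        using pos_range[OF v] by (cases "pos v") auto
      then show "s' POS v = pos v"
        using inv l_pos[OF v] unfolding Inv_def by metis
    qed
  qed simp
qed

lemma edges_run:
  assumes s: "s 0 0 = card V" "s 0 1 = length es" "\<And>v. v \<in> V \<Longrightarrow> s POS v = pos v"
    "\<And>j. j < length es \<Longrightarrow> s 0 (3 + card V + 2 * j) = fst (es ! j)"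
    "\<And>j. j < length es \<Longrightarrow> s 0 (4 + card V + 2 * j) = snd (es ! j)"
    and K: "card V < 2 ^ K" "length es < K"
  shows "run K (Suc (length es)) edges s ready"
proof -
  define Inv where "Inv = (\<lambda>k s'. s' PW k = 2 ^ k \<and>
    (\<forall>j<k. s' LF j = left_pos j \<and> s' RT j = right_pos j \<and> s' PW j = 2 ^ j))"
  have m: "length es < 2 ^ K"
    using K(2) less_exp[of K] by linarith
  have one: "1 < (2::nat) ^ K"
    using K(2) by (intro one_less_power) auto
  let ?s = "put s PW 0 1"
  have "run K (Suc (length es)) (For J Nedges edge_step) ?s (Inv (length es))"
  proof (rule run_for[where Y = 1])
    fix k s' assume k: "k < length es" "Inv k s'" "s' J 0 = k"
      and frame: "\<And>x. x \<noteq> J \<Longrightarrow> x \<notin> writes edge_step \<Longrightarrow> s' x = ?s x"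
    then have s': "s' 0 = s 0" "s' POS = s POS"
      by (simp_all add: edge_step_def put_array)
    note ends = edge_ends[OF k(1)]
    have pos_less: "pos (fst (es ! k)) < 2 ^ K" "pos (snd (es ! k)) < 2 ^ K"
      using pos_range[OF ends(1)] pos_range[OF ends(2)] K(1) by auto
    have less: "left_pos k < 2 ^ K" "right_pos k < 2 ^ K"
      using edge_by_pos(1,2)[OF k(1)] K by auto
    have pow: "2 * 2 ^ k < (2::nat) ^ K"
      using power_strict_increasing[of "Suc k" K "2::nat"] k(1) K(2) by simp
    have minmax: "pos (fst (es ! k)) - (pos (fst (es ! k)) - pos (snd (es ! k))) = left_pos k"
      "pos (fst (es ! k)) + (pos (snd (es ! k)) - pos (fst (es ! k))) = right_pos k"
      by (auto simp: left_pos_def right_pos_def)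
    have ends_at: "s 0 (3 + card V + 2 * k) = fst (es ! k)" "s 0 (4 + card V + 2 * k) = snd (es ! k)"
      "s POS (fst (es ! k)) = pos (fst (es ! k))" "s POS (snd (es ! k)) = pos (snd (es ! k))"
      using s k ends by auto
    have PW: "s' PW k = 2 ^ k"
      using k by (simp add: Inv_def)
    have "run K 1 edge_step s' (\<lambda>s''. s'' LF = (s' LF)(k := left_pos k) \<and>
      s'' RT = (s' RT)(k := right_pos k) \<and> s'' PW = (s' PW)(Suc k := 2 * 2 ^ k))"
      unfolding edge_step_def block.simps
      by (intro run_seq run_put run_skip)
        (simp_all add: put_array s' k(3) s(1) ends_at pos_less minmax less pow PW del: diff_diff_cancel)
    then show "run K 1 edge_step s' (\<lambda>s''. Inv (Suc k) (put s'' J 0 (Suc k)))"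
      by (rule run_mono) (use k in \<open>auto simp: Inv_def put_array less_Suc_eq\<close>)
  next
    fix s' assume "\<And>x. x \<noteq> J \<Longrightarrow> x \<notin> writes edge_step \<Longrightarrow> s' x = ?s x"
    then have "s' 0 = s 0"
      by (simp add: edge_step_def put_array)
    then show "aval Nedges s' = length es"
      using s by simp
  qed (use m in \<open>auto simp: Inv_def put_array edge_step_def\<close>)
  then have "run K (Suc (length es)) (For J Nedges edge_step) ?s ready"
    by (rule run_mono) (use s in \<open>auto simp: Inv_def ready_def edge_step_def put_array\<close>)
  then show ?thesis
    unfolding edges_def using one by (intro run_seq run_put) auto
qed

text \<open>The bound is that of the deepest nesting: vertices, edges, masks. The loops that read
  the input fit below it.\<close>

lemma program_run:
  assumes w: "\<And>i. card (active i) \<le> w" and K: "length es < K" "card V < 2 ^ K"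
    and xs: "xs = [card V, length es, k] @ map l [1..<card V + 1] @ concat (map (\<lambda>(u, v). [u, v]) es)"
  shows "run K (Suc (card V) * (Suc (length es) * (2 ^ w + 1))) oct_program (init xs)
    (\<lambda>s. result s = (if has_oct V E k then 1 else 0))"
proof -
  let ?Y = "Suc (length es) * (2 ^ w + 1) :: nat"
  let ?X = "Suc (card V) * ?Y"
  define s where "s = init xs"
  have len: "length xs = 3 + card V + 2 * length es"
    unfolding xs using length_concat_pairs[of es] by simp
  have s0: "s 0 0 = card V" "s 0 1 = length es" "s 0 2 = k"
    by (simp_all add: s_def init_def xs)
  have s_pos: "s 0 (3 + i) = l (Suc i)" if "i < card V" for i
    using that len by (simp add: s_def init_def) (simp add: xs nth_append del: upt_Suc)
  have s_edge: "s 0 (3 + card V + 2 * j) = fst (es ! j)" "s 0 (4 + card V + 2 * j) = snd (es ! j)"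
    if "j < length es" for j
    using that len nth_concat_pairs[OF that] by (simp_all add: s_def init_def) (simp_all add: xs nth_append del: upt_Suc)
  have s_zero: "s x i = 0" if "x \<noteq> 0" for x i
    using that by (simp add: s_def init_def)
  have Y: "1 \<le> ?Y" "Suc (length es) \<le> ?Y"
    by simp_all
  have XY: "?Y \<le> ?X"
    unfolding mult_Suc[of "card V"] by (rule le_add1)
  have X: "Suc (length es) \<le> ?X" "Suc (card V) \<le> ?X" "0 < ?X"
    using Y(2) XY by (linarith, simp, simp)
  have one: "1 < (2::nat) ^ K"
    using K(1) by (intro one_less_power) auto
  have r1: "run K ?X positions s (\<lambda>s'. (\<forall>v\<in>V. s' POS v = pos v) \<and>
      s' 0 = s 0 \<and> s' 1 = s 1 \<and> s' TAB = s TAB \<and> s' LIST = s LIST)"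
    by (rule run_mono[OF positions_run]) (use s0 s_pos K X in \<open>auto simp: positions_def\<close>)
  have r2: "run K ?X edges s1 (\<lambda>s'. ready s' \<and>
      s' 0 = s 0 \<and> s' 1 = s 1 \<and> s' TAB = s TAB \<and> s' LIST = s LIST)"
    if "(\<forall>v\<in>V. s1 POS v = pos v) \<and> s1 0 = s 0 \<and> s1 1 = s 1 \<and> s1 TAB = s TAB \<and> s1 LIST = s LIST" for s1
    by (rule run_mono[OF edges_run])
      (use that s0 s_edge K X in \<open>auto simp: edges_def edge_step_def\<close>)
  have r3: "run K ?X (Assign N (Num 1)) s1 (\<lambda>s'. ready s' \<and> layer s' 0 \<and> s' 0 = s 0 \<and> s' 1 = s 1)"
    if "ready s1 \<and> s1 0 = s 0 \<and> s1 1 = s 1 \<and> s1 TAB = s TAB \<and> s1 LIST = s LIST" for s1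
  proof (rule run_put)
    have "active 0 = {}"
      using edge_by_pos(1) by (fastforce simp: active_def)
    moreover have "least (conflicts 0) {} {} = 0"
      using least_le[of "{}" "{}" "conflicts 0" 0] conflicts_le[of 0] by simp
    ultimately have "layer (put s1 N 0 1) 0"
      using that by (simp add: layer_def listing_def table_def put_array s_zero bij_betw_def lessThan_Suc)
    then show "ready (put s1 N (aval (Num 0) s1) (aval (Num 1) s1)) \<and>
      layer (put s1 N (aval (Num 0) s1) (aval (Num 1) s1)) 0 \<and>
      put s1 N (aval (Num 0) s1) (aval (Num 1) s1) 0 = s 0 \<and> put s1 N (aval (Num 0) s1) (aval (Num 1) s1) 1 = s 1"
      using that s0 by (simp add: ready_def put_array)
  qed (use X one in auto)
  have r4: "run K ?X (For I Nvertices vertex_step) s1 (\<lambda>s'. layer s' (card V) \<and> s' 0 = s 0 \<and> s' 1 = s 1)"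
    if s1: "ready s1 \<and> layer s1 0 \<and> s1 0 = s 0 \<and> s1 1 = s 1" for s1
  proof -
    have writes: "writes vertex_step = {TAB, TABF, TABT, LIST, N, Q, R, M, J}"
      by (auto simp: vertex_step_def writes_steps)
    have layer_put: "layer (put s' I a v) i = layer s' i" for s' a v i
      by (simp add: layer_def listing_def table_def put_array)
    have "run K ?X (For I Nvertices vertex_step) s1 (\<lambda>s'. layer s' (card V))"
    proof (rule run_for[where Y = ?Y and I = "\<lambda>i s'. layer s' i"])
      fix i s' assume i: "i < card V" "layer s' i" "s' I 0 = i"
        and frame: "\<And>x. x \<noteq> I \<Longrightarrow> x \<notin> writes vertex_step \<Longrightarrow> s' x = s1 x"
      have "ready s'"
        using s1 s0 frame by (simp add: ready_def writes)
      then show "run K ?Y vertex_step s' (\<lambda>s''. layer (put s'' I 0 (Suc i)) (Suc i))"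
        unfolding layer_put by (intro vertex_run i K w)
    next
      fix s' assume "\<And>x. x \<noteq> I \<Longrightarrow> x \<notin> writes vertex_step \<Longrightarrow> s' x = s1 x"
      then have "s' 0 = s 0"
        using s1 by (simp add: writes)
      then show "aval Nvertices s' = card V"
        using s0 by simp
    qed (use s1 K in \<open>auto simp: layer_put writes\<close>)
    then show ?thesis
      by (rule run_mono) (use s1 in \<open>auto simp: writes\<close>)
  qed
  have r5: "run K ?X (If (Less Budget (Get TAB (Num 0))) Skip (Assign 1 (Num 1))) s1
      (\<lambda>s'. result s' = (if has_oct V E k then 1 else 0))"
    if s1: "layer s1 (card V) \<and> s1 0 = s 0 \<and> s1 1 = s 1" for s1
  proof -
    have "s1 TAB 0 = least (conflicts (card V)) {} {}"
      using s1 by (simp add: layer_def table_def active_last)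
    then have "k < s1 TAB 0 \<longleftrightarrow> \<not> has_oct V E k"
      by (simp add: has_oct_iff not_le)
    then show ?thesis
      using s1 s0 s_zero[of 1] one X by (intro run_if run_skip run_put) (auto simp: result_def put_array)
  qed
  show ?thesis
    unfolding oct_program_def block.simps s_def[symmetric]
    by (rule run_seq_frame, rule r1, rule order_refl, rule run_seq_frame, erule r2, rule order_refl,
      rule run_seq_frame, erule r3, rule order_refl, rule run_seq_frame, erule r4, rule order_refl,
      rule run_seq_frame, erule r5, rule order_refl, rule run_skip, rule X(3))
qed

end

theorem theorem36:
  shows "\<exists>(c :: com) (p :: nat poly).
    \<forall>(V :: nat set) (E :: nat set set) (l :: nat \<Rightarrow> nat) (ctw :: nat) (k :: nat) (xs :: nat list).
      simple_graph V E \<and> linear_arrangement V l \<and> cutwidth V E l \<le> ctw \<and> k > 0 \<and>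
      encodes xs V E l k \<longrightarrow>
      (\<exists>t s. exec c (init xs) t s \<and>
        result s = (if has_oct V E k then 1 else 0) \<and>
        t \<le> 2 ^ ctw * poly p (input_size xs))"
proof (rule exI[of _ oct_program], rule exI[of _ "smult (2 * weight oct_program) ([:1, 1:] ^ 3)"],
    intro allI impI)
  \<comment> \<open>One factor of input size plus 1 each for the vertices, the edges and the word
    length; the 2 comes from \<open>2 ^ ctw + 1 \<le> 2 * 2 ^ ctw\<close>.\<close>
  let ?p = "smult (2 * weight oct_program) ([:1, 1:] ^ 3) :: nat poly"
  fix V E l ctw k xs
  assume "simple_graph V E \<and> linear_arrangement V l \<and> cutwidth V E l \<le> ctw \<and> k > 0 \<and> encodes xs V E l k"
  then obtain es where arr: "simple_graph V E" "linear_arrangement V l" "cutwidth V E l \<le> ctw"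
    and es: "distinct (map (\<lambda>(u, v). {u, v}) es)" "set (map (\<lambda>(u, v). {u, v}) es) = E"
    and xs: "xs = [card V, length es, k] @ map l [1..<card V + 1] @ concat (map (\<lambda>(u, v). [u, v]) es)"
    unfolding encodes_def by blast
  interpret arranged_graph V E l es
    by unfold_locales (fact arr es)+
  let ?S = "input_size xs"
  have len: "length xs = 3 + card V + 2 * length es"
    unfolding xs using length_concat_pairs[of es] by simp
  then have size: "Suc (length es) \<le> Suc ?S" "Suc (card V) \<le> Suc ?S"
    using length_le_input_size[of xs] by simp_all
  \<comment> \<open>The word length is \<open>Suc ?S\<close>, because the number of edges must lie
    strictly below it; \<open>card V\<close> and all input numbers then fit into a cell.\<close>
  have "card V < 2 ^ Suc ?S"
    using size(2) less_exp[of "Suc ?S"] by linarith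
  moreover have "card (active i) \<le> ctw" for i
    using card_active_le arr(3) by (rule order_trans)
  ultimately have run: "run (Suc ?S) (Suc (card V) * (Suc (length es) * (2 ^ ctw + 1))) oct_program (init xs)
      (\<lambda>s. result s = (if has_oct V E k then 1 else 0))"
    using size xs by (intro program_run) auto
  have "init xs x i < 2 ^ Suc ?S" for x i
    using less_power_input_size[of "xs ! i" xs] by (auto simp: init_def intro: less_le_trans)
  then have "small (Suc ?S) (init xs)"
    by (simp add: small_def)
  with run obtain t s where t: "exec oct_program (init xs) t s"
    "t \<le> weight oct_program * (Suc (card V) * (Suc (length es) * (2 ^ ctw + 1))) * Suc ?S"
    "result s = (if has_oct V E k then 1 else 0)"
    unfolding run_def by blast
  have "Suc (card V) * (Suc (length es) * (2 ^ ctw + 1)) \<le> Suc ?S * (Suc ?S * (2 * 2 ^ ctw))"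
    using size by (intro mult_le_mono) auto
  then have "t \<le> weight oct_program * (Suc ?S * (Suc ?S * (2 * 2 ^ ctw))) * Suc ?S"
    using t(2) by (meson le_trans mult_le_mono1 mult_le_mono2)
  also have "\<dots> = 2 ^ ctw * poly ?p ?S"
    by (simp add: power3_eq_cube algebra_simps)
  finally show "\<exists>t s. exec oct_program (init xs) t s \<and> result s = (if has_oct V E k then 1 else 0) \<and>
      t \<le> 2 ^ ctw * poly ?p ?S"
    using t by blast
qed

end
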